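(* Let $\mathbf{W}=\{\mathbf{W}(t):t\ge 0\}$ be standard planar Brownian motion started at the origin, and for $t\ge 0$ let $\mathsf{r}(t)$ be the inradius of $\mathrm{H}(t)=\operatorname{conv}\{\mathbf{W}(s):s\in[0,t]\}$. Let $\Theta^{\mathsf{r}}=\inf\{t\ge 0:\mathsf{r}(t)>1\}$. Then $$2\le \mathbb{E}\left[\Theta^{\mathsf{r}}\right]\le 83.4.$$
   Context: Standard planar Brownian motion is $\mathbf{W}(t)=(W_1(t),W_2(t))$ with $W_1,W_2$ independent one-dimensional standard Brownian motions started at $0$. $\operatorname{conv}A$ is the convex hull of $A\subset\mathbb{R}^2$. The inradius of a planar convex set is the radius of the largest disk contained in it. *)

theory Defs
  imports "HOL-Probability.Probability"
begin

(* The argument of normal_density is the standard deviation, hence sqrt (t - s) for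
   an increment of variance t - s. *)
locale standard_brownian_motion = prob_space M
  for M :: "'a measure" +
  fixes B :: "real \<Rightarrow> 'a \<Rightarrow> real"
  assumes random_variable: "\<And>t. 0 \<le> t \<Longrightarrow> random_variable borel (B t)"
    and start_zero: "AE \<omega> in M. B 0 \<omega> = 0"
    and indep_increments:
      "\<And>(n::nat) t. 0 \<le> t 0 \<Longrightarrow> (\<And>i. i < n \<Longrightarrow> t i < t (Suc i)) \<Longrightarrow>
         indep_vars (\<lambda>_. borel) (\<lambda>i \<omega>. B (t (Suc i)) \<omega> - B (t i) \<omega>) {..<n}"
    and normal_increments:
      "\<And>s t. 0 \<le> s \<Longrightarrow> s < t \<Longrightarrow>
         distributed M lborel (\<lambda>\<omega>. B t \<omega> - B s \<omega>) (normal_density 0 (sqrt (t - s)))"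
    and continuous_paths: "AE \<omega> in M. continuous_on {0..} (\<lambda>t. B t \<omega>)"

(* The two coordinates are independent as processes: each is regarded as one random
   element of the product space of functions on the half-line. *)
locale standard_planar_brownian_motion = prob_space M
  for M :: "'a measure" +
  fixes W :: "real \<Rightarrow> 'a \<Rightarrow> real ^ 2"
  assumes coord1: "standard_brownian_motion M (\<lambda>t \<omega>. W t \<omega> $ 1)"
    and coord2: "standard_brownian_motion M (\<lambda>t \<omega>. W t \<omega> $ 2)"
    and indep_coords:
      "indep_var (Pi\<^sub>M {0..} (\<lambda>_. borel)) (\<lambda>\<omega>. \<lambda>t\<in>{0..}. W t \<omega> $ 1)
                 (Pi\<^sub>M {0..} (\<lambda>_. borel)) (\<lambda>\<omega>. \<lambda>t\<in>{0..}. W t \<omega> $ 2)"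

(* Meant for nonempty bounded K, where the supremum is over a nonempty bounded set;
   a single point counts as a disk of radius 0. For compact K it is a maximum. *)
definition inradius :: "(real ^ 2) set \<Rightarrow> real" where
  "inradius K = Sup {\<rho>. 0 \<le> \<rho> \<and> (\<exists>c. cball c \<rho> \<subseteq> K)}"

definition path_hull :: "(real \<Rightarrow> 'a \<Rightarrow> real ^ 2) \<Rightarrow> 'a \<Rightarrow> real \<Rightarrow> (real ^ 2) set" where
  "path_hull W \<omega> t = convex hull ((\<lambda>s. W s \<omega>) ` {0..t})"

(* Valued in ennreal so that the infimum of the empty set is infinity. *)
definition inradius_time :: "(real \<Rightarrow> 'a \<Rightarrow> real ^ 2) \<Rightarrow> 'a \<Rightarrow> ennreal" where
  "inradius_time W \<omega> = (INF t\<in>{t. 0 \<le> t \<and> inradius (path_hull W \<omega> t) > 1}. ennreal t)"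

end

theory Submission
  imports Defs "HOL-Real_Asymp.Real_Asymp"
begin

text \<open>
  Upper bound. Sample the path at the times \<open>7 n\<close>. First wait for an increment of length at least
  \<open>4.3\<close>, which has probability \<open>exp (- 4.3\<^sup>2 / 14) \<ge> 0.26\<close> at each step. This gives two visited
  points at distance at least \<open>4.3\<close>; from then on keep such a pair \<open>P, Q\<close>, replaced by one at least
  as long whenever the current position leaves the lens in which both of its distances to \<open>P\<close> and \<open>Q\<close> are
  smaller than the distance of \<open>P\<close> and \<open>Q\<close>, so that the projection of the current position always
  lies between \<open>P\<close> and \<open>Q\<close>. By rotation invariance the next increment has independent normal
  components along and across the line \<open>P Q\<close>, and with probability at least \<open>1 / 8\<close> the new position
  has height at least \<open>3.24\<close> above a point of the line at distance at most \<open>1\<close> from the segment;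
  then the triangle contains a disc of radius larger than \<open>1\<close>. Hence the expectation is at most
  \<open>7 (1 / 0.26 + 8) < 83.4\<close>.

  Lower bound. Inradius larger than \<open>1\<close> forces the range of the first coordinate to exceed \<open>2\<close>.
  For a walk \<open>S\<close> with running maximum \<open>M\<close> and running minimum \<open>m\<close>, the quantity
  \<open>((M - S)\<^sup>2 + (S - m)\<^sup>2) / 2\<close> grows in expectation by at most the variance of the step, and it is
  at least \<open>2\<close> when the range first exceeds \<open>2\<close>, since \<open>S\<close> is then extremal. Applying this to finer
  and finer grids bounds the expected time from below by \<open>2\<close>.
\<close>

section \<open>Discs in triangles\<close>

text \<open>The centre is the incentre; the barycentric coordinates stay nonnegative on the disc.\<close>
lemma cball_subset_triangle:
  fixes A B C :: complex
  defines "d \<equiv> Im (cnj (B - A) * (C - A))"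
    and "l \<equiv> norm (B - A) + norm (C - A) + norm (C - B)"
  assumes "d \<noteq> 0"
  shows "cball ((norm (C - B) *\<^sub>R A + norm (C - A) *\<^sub>R B + norm (B - A) *\<^sub>R C) /\<^sub>R l) (\<bar>d\<bar> / l)
      \<subseteq> convex hull {A, B, C}"
proof
  fix X
  define I where "I = (norm (C - B) *\<^sub>R A + norm (C - A) *\<^sub>R B + norm (B - A) *\<^sub>R C) /\<^sub>R l"
  assume "X \<in> cball ((norm (C - B) *\<^sub>R A + norm (C - A) *\<^sub>R B + norm (B - A) *\<^sub>R C) /\<^sub>R l) (\<bar>d\<bar> / l)"
  then have w: "norm (X - I) \<le> \<bar>d\<bar> / l"
    by (simp add: I_def dist_norm norm_minus_commute)
  have "B \<noteq> A" using assms(3) by (auto simp: d_def)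
  then have l: "l > 0" by (simp add: l_def add_pos_nonneg)
  \<comment> \<open>A displacement of length at most \<open>\<bar>d\<bar> / l\<close> changes the
    barycentric coordinate opposite the side \<open>D\<close> by at most \<open>norm D / l\<close>,
    which is the weight that the incentre gives to it.\<close>
  have bound: "\<bar>Im (cnj D * (X - I)) / d\<bar> \<le> norm D / l" for D
  proof -
    have "\<bar>Im (cnj D * (X - I))\<bar> \<le> norm D * norm (X - I)"
      using abs_Im_le_cmod[of "cnj D * (X - I)"] by (simp add: norm_mult)
    also have "\<dots> \<le> norm D * (\<bar>d\<bar> / l)"
      by (intro mult_left_mono w) auto
    finally show ?thesis
      using \<open>d \<noteq> 0\<close> l by (simp add: field_simps)
  qed
  define c where "c = norm (B - A) / l + Im (cnj (B - A) * (X - I)) / d"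
  define b where "b = norm (C - A) / l - Im (cnj (C - A) * (X - I)) / d"
  define a where "a = norm (C - B) / l + Im (cnj (C - B) * (X - I)) / d"
  have nonneg: "0 \<le> a" "0 \<le> b" "0 \<le> c"
    using bound[of "B - A"] bound[of "C - A"] bound[of "C - B"]
    unfolding a_def b_def c_def by linarith+
  have "Im (cnj (B - A) * (X - I)) - Im (cnj (C - A) * (X - I)) + Im (cnj (C - B) * (X - I)) = 0"
    by (simp add: algebra_simps)
  then have "(Im (cnj (B - A) * (X - I)) - Im (cnj (C - A) * (X - I)) + Im (cnj (C - B) * (X - I))) / d = 0"
    by simp
  moreover have "norm (C - B) / l + norm (C - A) / l + norm (B - A) / l = 1"
    using l by (simp add: l_def add_ac flip: add_divide_distrib)
  ultimately have sum1: "a + b + c = 1"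
    by (simp add: a_def b_def c_def add_divide_distrib diff_divide_distrib)
  \<comment> \<open>Cramer's rule in the plane. The three coefficients sum to zero, so for
    \<open>w = X - I\<close> they can be divided by \<open>d\<close> and added to the weights of the
    incentre.\<close>
  have key: "d *\<^sub>R w = Im (cnj (C - B) * w) *\<^sub>R A - Im (cnj (C - A) * w) *\<^sub>R B + Im (cnj (B - A) * w) *\<^sub>R C" for w
    by (simp add: d_def complex_eq_iff algebra_simps)
  have I: "I = (norm (C - B) / l) *\<^sub>R A + (norm (C - A) / l) *\<^sub>R B + (norm (B - A) / l) *\<^sub>R C"
    by (simp add: I_def scaleR_add_right divide_inverse mult.commute)
  have mults: "d * a = d * (norm (C - B) / l) + Im (cnj (C - B) * (X - I))"
    "d * b = d * (norm (C - A) / l) - Im (cnj (C - A) * (X - I))"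
    "d * c = d * (norm (B - A) / l) + Im (cnj (B - A) * (X - I))"
    unfolding a_def b_def c_def distrib_left right_diff_distrib using \<open>d \<noteq> 0\<close> by auto
  have "d *\<^sub>R (a *\<^sub>R A + b *\<^sub>R B + c *\<^sub>R C) = (d * a) *\<^sub>R A + (d * b) *\<^sub>R B + (d * c) *\<^sub>R C"
    by (simp add: scaleR_add_right)
  also have "\<dots> = d *\<^sub>R I + d *\<^sub>R (X - I)"
    unfolding mults key[of "X - I"] by (subst (4) I) (simp only: scaleR_add_right scaleR_add_left scaleR_diff_left scaleR_scaleR algebra_simps)
  also have "\<dots> = d *\<^sub>R X"
    by (simp add: scaleR_diff_right)
  finally have "X = a *\<^sub>R A + b *\<^sub>R B + c *\<^sub>R C"
    using \<open>d \<noteq> 0\<close> by simp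
  then show "X \<in> convex hull {A, B, C}"
    using nonneg sum1 unfolding convex_hull_3 by blast
qed

text \<open>
  In the frame with origin \<open>P\<close> and first axis towards \<open>Q\<close>: \<open>P\<close> and \<open>Q\<close> have distance at least \<open>4.3\<close>,
  the point \<open>Z\<close> has height at least \<open>3.24\<close>, and its projection lies at distance at most \<open>1\<close> from the
  segment.
\<close>
definition wide_triangle :: "complex \<Rightarrow> complex \<Rightarrow> complex \<Rightarrow> bool" where
  "wide_triangle P Q Z \<longleftrightarrow>
     43 / 10 \<le> norm (Q - P) \<and>
     - norm (Q - P) \<le> Re (cnj (Q - P) * (Z - P)) \<and>
     Re (cnj (Q - P) * (Z - P)) \<le> (norm (Q - P))\<^sup>2 + norm (Q - P) \<and>
     81 / 25 * norm (Q - P) \<le> \<bar>Im (cnj (Q - P) * (Z - P))\<bar>"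

text \<open>The triangle with base \<open>4.3\<close> and apex \<open>(x, y)\<close> has twice its
  area on the right and its perimeter on the left, so its inradius exceeds \<open>1\<close>. By
  convexity the legs at height \<open>3.24\<close> are controlled by the ends \<open>x = -1\<close>
  and \<open>x = 5.3\<close>, where their sum is at most \<open>3.391 + 6.212\<close>, and
  \<open>9.603 + 4.3 < 4.3 * 3.24 = 13.932\<close>. Raising the apex adds at most \<open>2\<close>
  per unit on the left and \<open>4.3\<close> on the right.\<close>

lemma leg_sum_bound:
  fixes x y :: real
  assumes x: "-1 \<le> x" "x \<le> 53 / 10" and y: "81 / 25 \<le> \<bar>y\<bar>"
  shows "norm (Complex x y) + norm (Complex (x - 43 / 10) y) + 43 / 10 < 43 / 10 * \<bar>y\<bar>"
proof -
  define t where "t = (x + 1) / (63 / 10)"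
  have t: "0 \<le> t" "t \<le> 1" using x by (auto simp: t_def)
  let ?h = "81 / 25 :: real"
  have s1: "norm (Complex 1 ?h) \<le> 3391 / 1000"
    unfolding cmod_def by (rule real_le_lsqrt) (auto simp: power2_eq_square)
  have s1': "norm (Complex (- 1) ?h) \<le> 3391 / 1000"
    unfolding cmod_def by (rule real_le_lsqrt) (auto simp: power2_eq_square)
  have s2: "norm (Complex (53 / 10) ?h) \<le> 6212 / 1000"
    unfolding cmod_def by (rule real_le_lsqrt) (auto simp: power2_eq_square)
  have s2': "norm (Complex (- (53 / 10)) ?h) \<le> 6212 / 1000"
    unfolding cmod_def by (rule real_le_lsqrt) (auto simp: power2_eq_square)
  have conv: "norm ((1 - t) *\<^sub>R u + t *\<^sub>R v) \<le> (1 - t) * norm u + t * norm v" for u v :: complex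
    using norm_triangle_ineq[of "(1 - t) *\<^sub>R u" "t *\<^sub>R v"] t by simp
  have "Complex x ?h = (1 - t) *\<^sub>R Complex (- 1) ?h + t *\<^sub>R Complex (53 / 10) ?h"
    by (simp add: complex_eq_iff t_def field_simps)
  then have "norm (Complex x ?h) \<le> (1 - t) * norm (Complex (- 1) ?h) + t * norm (Complex (53 / 10) ?h)"
    using conv by simp
  also have "\<dots> \<le> (1 - t) * (3391 / 1000) + t * (6212 / 1000)"
    using t by (intro add_mono mult_left_mono s1' s2) auto
  finally have b1: "norm (Complex x ?h) \<le> (1 - t) * (3391 / 1000) + t * (6212 / 1000)" .
  have "Complex (x - 43 / 10) ?h = (1 - t) *\<^sub>R Complex (- (53 / 10)) ?h + t *\<^sub>R Complex 1 ?h"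
    by (simp add: complex_eq_iff t_def field_simps)
  then have "norm (Complex (x - 43 / 10) ?h)
      \<le> (1 - t) * norm (Complex (- (53 / 10)) ?h) + t * norm (Complex 1 ?h)"
    using conv by simp
  also have "\<dots> \<le> (1 - t) * (6212 / 1000) + t * (3391 / 1000)"
    using t by (intro add_mono mult_left_mono s2' s1) auto
  finally have b2: "norm (Complex (x - 43 / 10) ?h) \<le> (1 - t) * (6212 / 1000) + t * (3391 / 1000)" .
  have lip: "norm (Complex z y) \<le> norm (Complex z ?h) + (\<bar>y\<bar> - ?h)" for z
  proof -
    have "norm (Complex z y) = norm (Complex z ?h + Complex 0 (\<bar>y\<bar> - ?h))"
      by (simp add: cmod_def)
    also have "\<dots> \<le> norm (Complex z ?h) + norm (Complex 0 (\<bar>y\<bar> - ?h))"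
      by (rule norm_triangle_ineq)
    also have "norm (Complex 0 (\<bar>y\<bar> - ?h)) = \<bar>y\<bar> - ?h"
      using y by (simp add: cmod_def)
    finally show ?thesis .
  qed
  define Y where "Y = \<bar>y\<bar>"
  \<comment> \<open>The ends \<open>-1\<close> and \<open>5.3\<close> are symmetric about the
    midpoint of the base, so the two legs carry the weights \<open>t\<close> and
    \<open>1 - t\<close> in exchanged roles and \<open>t\<close> cancels in the sum.\<close>
  have "norm (Complex x ?h) + norm (Complex (x - 43 / 10) ?h) \<le> 9603 / 1000"
  proof -
    have "(1 - t) * (3391 / 1000) + t * (6212 / 1000) + ((1 - t) * (6212 / 1000) + t * (3391 / 1000)) = 9603 / 1000"
      by (simp add: field_simps)
    then show ?thesis using b1 b2 by linarith
  qed
  then have "norm (Complex x y) + norm (Complex (x - 43 / 10) y) \<le> 9603 / 1000 + 2 * (Y - ?h)"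
    using lip[of x] lip[of "x - 43 / 10"] unfolding Y_def[symmetric] by argo
  then show ?thesis
    using y unfolding Y_def[symmetric] by argo
qed

text \<open>Planar geometry is done with complex numbers, where \<open>cnj u * w\<close> has the
  inner product as real part and the cross product as imaginary part. This linear isometry carries
  it back to \<open>real ^ 2\<close>.\<close>

definition plane_of :: "complex \<Rightarrow> real ^ 2" where
  "plane_of z = vector [Re z, Im z]"

lemma plane_of_nth [simp]: "plane_of z $ 1 = Re z" "plane_of z $ 2 = Im z"
  by (simp_all add: plane_of_def)

lemma linear_plane_of: "linear plane_of"
  by (rule linearI) (simp_all add: vec_eq_iff forall_2)

lemma norm_plane_of: "norm (plane_of z) = norm z"
  by (simp add: norm_vec_def L2_set_def sum_2 cmod_def)

lemma plane_of_cball: "plane_of ` cball c \<rho> = cball (plane_of c) \<rho>"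
proof -
  have d: "dist (plane_of c) (plane_of z) = dist c z" for z
    by (simp add: dist_norm norm_plane_of flip: linear_diff[OF linear_plane_of])
  have "x \<in> plane_of ` cball c \<rho>" if "x \<in> cball (plane_of c) \<rho>" for x
  proof (rule image_eqI)
    show "x = plane_of (Complex (x $ 1) (x $ 2))" by (simp add: vec_eq_iff forall_2)
    then show "Complex (x $ 1) (x $ 2) \<in> cball c \<rho>"
      using that d[of "Complex (x $ 1) (x $ 2)"] by simp
  qed
  then show ?thesis by (auto simp: d)
qed

text \<open>Boundedness of \<open>K\<close> bounds the radii of its discs, so the real
  \<open>Sup\<close> is a genuine upper bound of them.\<close>

lemma less_inradius:
  assumes "cball c \<rho> \<subseteq> K" "bounded K" "1 < \<rho>"
  shows "1 < inradius K"
proof -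
  define S where "S = {\<rho>. 0 \<le> \<rho> \<and> (\<exists>c. cball c \<rho> \<subseteq> K)}"
  obtain b where b: "K \<subseteq> cball 0 b"
    using \<open>bounded K\<close> unfolding bounded_any_center[of K 0] by (auto simp: subset_eq)
  have "r \<le> b" if "r \<in> S" for r
  proof -
    from that obtain d where d: "0 \<le> r" "cball d r \<subseteq> K" unfolding S_def by blast
    from d(2) b have "cball d r \<subseteq> cball 0 b" by (rule order_trans)
    with d(1) have "dist d 0 + r \<le> b" unfolding cball_subset_cball_iff by linarith
    then show "r \<le> b" using zero_le_dist[of d 0] by linarith
  qed
  then have "bdd_above S" by (rule bdd_aboveI)
  moreover have "\<rho> \<in> S"
    unfolding S_def mem_Collect_eq using assms(1,3) by (intro conjI exI[of _ c]) linarith+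
  ultimately have "\<rho> \<le> Sup S" by (rule cSup_upper[rotated])
  then show ?thesis
    using assms(3) unfolding inradius_def S_def by linarith
qed

text \<open>The base is cut down to a part of length exactly \<open>4.3\<close>, slid as close to
  the foot of the apex as the base allows. In the smaller triangle twice the area exceeds the
  perimeter, so its incircle has radius above \<open>1\<close>.\<close>

lemma wide_triangle_contains_disc:
  assumes "wide_triangle P Q Z"
  shows "\<exists>c \<rho>. 1 < \<rho> \<and> cball c \<rho> \<subseteq> convex hull {P, Q, Z}"
proof -
  define R where "R = norm (Q - P)"
  define e where "e = (Q - P) /\<^sub>R R"
  define x where "x = Re (cnj (Q - P) * (Z - P)) / R"
  define y where "y = Im (cnj (Q - P) * (Z - P)) / R"
  have R: "43 / 10 \<le> R" using assms by (simp add: wide_triangle_def R_def)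
  have x: "-1 \<le> x" "x \<le> R + 1" and y: "81 / 25 \<le> \<bar>y\<bar>"
    using assms R unfolding wide_triangle_def R_def[symmetric] x_def y_def
    by (auto simp: field_simps power2_eq_square)
  have e: "norm e = 1" using R by (simp add: e_def R_def) (auto simp: field_simps)
  have ce: "cnj e * e = 1"
    using e by (metis complex_norm_square mult.commute of_real_1 one_power2)
  have ZP: "cnj e * (Z - P) = Complex x y"
  proof -
    have "cnj e * (Z - P) = (cnj (Q - P) * (Z - P)) /\<^sub>R R"
      by (simp add: e_def)
    then show ?thesis
      by (simp add: x_def y_def complex_eq_iff divide_inverse mult.commute)
  qed
  \<comment> \<open>The foot \<open>x\<close> clamped to \<open>[0, R - 4.3]\<close>: the shortened
    base then lies on the original one, and the foot relative to its start lies in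
    \<open>[-1, 5.3]\<close>.\<close>
  define \<tau> where "\<tau> = max 0 (min (R - 43 / 10) x)"
  have \<tau>: "0 \<le> \<tau>" "\<tau> + 43 / 10 \<le> R" "-1 \<le> x - \<tau>" "x - \<tau> \<le> 53 / 10"
    using R x by (auto simp: \<tau>_def max_def min_def)
  define P' where "P' = P + \<tau> *\<^sub>R e"
  define Q' where "Q' = P + (\<tau> + 43 / 10) *\<^sub>R e"
  \<comment> \<open>Multiplication by \<open>cnj e\<close> is the rotation to the frame whose first
    axis points from \<open>P\<close> to \<open>Q\<close>.\<close>
  have rot: "norm w = norm (cnj e * w)" for w
    using e by (simp add: norm_mult)
  have ZP': "cnj e * (Z - P') = Complex (x - \<tau>) y"
  proof -
    have "cnj e * (Z - P') = cnj e * (Z - P) - \<tau> *\<^sub>R (cnj e * e)"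
      by (simp add: P'_def algebra_simps)
    then show ?thesis by (simp add: ZP ce complex_eq_iff)
  qed
  have ZQ': "cnj e * (Z - Q') = Complex (x - \<tau> - 43 / 10) y"
  proof -
    have "cnj e * (Z - Q') = cnj e * (Z - P) - (\<tau> + 43 / 10) *\<^sub>R (cnj e * e)"
      by (simp add: Q'_def algebra_simps)
    then show ?thesis by (simp add: ZP ce complex_eq_iff)
  qed
  have PQ': "Q' - P' = (43 / 10) *\<^sub>R e"
    by (simp add: P'_def Q'_def algebra_simps)
  define d where "d = Im (cnj (Q' - P') * (Z - P'))"
  define l where "l = norm (Q' - P') + norm (Z - P') + norm (Z - Q')"
  have "d = 43 / 10 * y"
  proof -
    have "cnj (Q' - P') * (Z - P') = (43 / 10) *\<^sub>R Complex (x - \<tau>) y"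
      unfolding PQ' ZP'[symmetric] by simp
    then show ?thesis by (simp add: d_def)
  qed
  moreover have "l = 43 / 10 + norm (Complex (x - \<tau>) y) + norm (Complex (x - \<tau> - 43 / 10) y)"
    unfolding l_def rot[of "Z - P'"] rot[of "Z - Q'"] ZP' ZQ' by (simp add: PQ' e)
  ultimately have "l < \<bar>d\<bar>"
    using leg_sum_bound[OF \<tau>(3,4) y] by (simp add: abs_mult)
  moreover have "0 < l" by (simp add: l_def PQ' e add_pos_nonneg)
  ultimately have "1 < \<bar>d\<bar> / l" "d \<noteq> 0" by auto
  moreover have "convex hull {P', Q', Z} \<subseteq> convex hull {P, Q, Z}"
  proof (rule hull_minimal)
    have seg: "P + t *\<^sub>R e \<in> convex hull {P, Q, Z}" if "0 \<le> t" "t \<le> R" for t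
    proof -
      have "P + t *\<^sub>R e = (1 - t / R) *\<^sub>R P + (t / R) *\<^sub>R Q + 0 *\<^sub>R Z"
      proof -
        have "t *\<^sub>R e = (t / R) *\<^sub>R Q - (t / R) *\<^sub>R P"
          by (simp add: e_def divide_inverse scaleR_diff_right)
        then show ?thesis by (simp add: scaleR_diff_left)
      qed
      then show ?thesis
        using that R unfolding convex_hull_3 mem_Collect_eq
        by (intro exI[of _ "1 - t / R"] exI[of _ "t / R"] exI[of _ 0] conjI) simp_all
    qed
    show "{P', Q', Z} \<subseteq> convex hull {P, Q, Z}"
      using seg[of \<tau>] seg[of "\<tau> + 43 / 10"] \<tau> by (auto simp: P'_def Q'_def hull_inc)
  qed simp
  ultimately show ?thesis
    using cball_subset_triangle[of Q' P' Z] unfolding d_def l_def by blast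
qed

section \<open>The normal law on the line\<close>

text \<open>The parameter is the variance, that is, the length of the time step.\<close>

abbreviation normal_law :: "real \<Rightarrow> real measure" where
  "normal_law s \<equiv> density lborel (\<lambda>x. ennreal (normal_density 0 (sqrt s) x))"

lemma prob_space_normal_law: "0 < s \<Longrightarrow> prob_space (normal_law s)"
  by (rule prob_space_normal_density) simp

lemma continuous_on_normal_density: "continuous_on A (normal_density \<mu> \<sigma>)"
  unfolding normal_density_def divide_inverse by (intro continuous_intros)

lemma emeasure_normal_law_Icc:
  assumes "0 < s"
  shows "emeasure (normal_law s) {a..b} = ennreal (integral {a..b} (normal_density 0 (sqrt s)))"
proof -
  interpret prob_space "normal_law s" by (rule prob_space_normal_law[OF assms])
  have "emeasure (normal_law s) {a..b} = (\<integral>\<^sup>+x\<in>{a..b}. normal_density 0 (sqrt s) x \<partial>lborel)"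
    by (subst emeasure_density) auto
  moreover have "emeasure (normal_law s) {a..b} < \<infinity>"
    by (simp add: emeasure_eq_measure)
  ultimately show ?thesis
    by (subst set_nn_integral_lborel_eq_integral[symmetric]) (auto simp: set_borel_measurable_def)
qed

text \<open>The Lagrange remainder is a positive multiple of \<open>x ^ n\<close>, hence nonnegative
  for even \<open>n\<close>. For odd \<open>n\<close> and \<open>x \<le> 0\<close> it is at most
  zero, which gives the upper bound that follows.\<close>

lemma exp_lower_Taylor_even:
  fixes x :: real
  assumes "even n"
  shows "(\<Sum>m<n. x ^ m / fact m) \<le> exp x"
  using Maclaurin_exp_le[of x n] assms by (auto simp: zero_le_even_power)

lemma exp_upper_Taylor_odd:
  fixes x :: real
  assumes "odd n" "x \<le> 0"
  shows "exp x \<le> (\<Sum>m<n. x ^ m / fact m)"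
proof -
  have "x ^ n \<le> 0" using assms by (simp add: power_le_zero_eq odd_pos)
  then show ?thesis
    using Maclaurin_exp_le[of x n] by (auto simp: mult_nonneg_nonpos divide_nonpos_pos)
qed

text \<open>Together with the Taylor bounds this turns a Gaussian integral into a finite rational
  sum; \<open>s\<close> stands for twice the variance.\<close>

lemma has_integral_gaussian_Taylor:
  fixes a b s :: real
  assumes "a \<le> b"
  shows "((\<lambda>x. \<Sum>m<n. (- x\<^sup>2 / s) ^ m / fact m) has_integral
     (\<Sum>m<n. (- 1 / s) ^ m * (b ^ (2 * m + 1) - a ^ (2 * m + 1)) / (fact m * (2 * real m + 1)))) {a..b}"
proof -
  have "((\<lambda>x. (- x\<^sup>2 / s) ^ m / fact m) has_integral
     (- 1 / s) ^ m * (b ^ (2 * m + 1) - a ^ (2 * m + 1)) / (fact m * (2 * real m + 1))) {a..b}" for m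
  proof -
    let ?F = "\<lambda>x. (- 1 / s) ^ m / fact m * (x ^ (2 * m + 1) / (2 * real m + 1))"
    have "((\<lambda>x. (- 1 / s) ^ m / fact m * x ^ (2 * m)) has_integral (?F b - ?F a)) {a..b}"
    proof (rule fundamental_theorem_of_calculus[OF assms])
      fix x :: real
      have "2 * real m + 1 \<noteq> 0" by linarith
      have "((\<lambda>x. x ^ (2 * m + 1)) has_real_derivative (2 * real m + 1) * x ^ (2 * m)) (at x within {a..b})"
        using DERIV_pow[of "2 * m + 1" x] by (simp add: add.commute)
      from DERIV_cmult[OF DERIV_cdivide[OF this, of "2 * real m + 1"], of "(- 1 / s) ^ m / fact m"]
      show "(?F has_vector_derivative (- 1 / s) ^ m / fact m * x ^ (2 * m)) (at x within {a..b})"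
        unfolding has_real_derivative_iff_has_vector_derivative[symmetric]
        using \<open>2 * real m + 1 \<noteq> 0\<close> by simp
    qed
    moreover have "(\<lambda>x. (- 1 / s) ^ m / fact m * x ^ (2 * m)) = (\<lambda>x. (- x\<^sup>2 / s) ^ m / fact m)"
    proof
      fix x :: real
      have "- x\<^sup>2 / s = (- 1 / s) * x\<^sup>2" by simp
      then show "(- 1 / s) ^ m / fact m * x ^ (2 * m) = (- x\<^sup>2 / s) ^ m / fact m"
        by (simp only: power_mult power_mult_distrib) simp
    qed
    moreover have "?F b - ?F a = (- 1 / s) ^ m * (b ^ (2 * m + 1) - a ^ (2 * m + 1)) / (fact m * (2 * real m + 1))"
      by (simp only: diff_divide_distrib right_diff_distrib times_divide_times_eq)
    ultimately show ?thesis
      by simp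
  qed
  then show ?thesis by (intro has_integral_sum) auto
qed

text \<open>Moving the centre \<open>x \<ge> 0\<close> of an interval of half-length
  \<open>L\<close> changes its mass at the rate \<open>g (x + L) - g (x - L)\<close>, which is at
  most zero since \<open>x + L\<close> is at least as far from the origin as \<open>x - L\<close>.
  Evenness of the density reduces the claim to nonnegative centres.\<close>

lemma normal_Icc_mono_centre:
  fixes L m m' s :: real
  assumes "0 \<le> L" "\<bar>m\<bar> \<le> \<bar>m'\<bar>" "0 < s"
  shows "integral {m' - L..m' + L} (normal_density 0 (sqrt s))
       \<le> integral {m - L..m + L} (normal_density 0 (sqrt s))"
proof -
  define g where "g = normal_density 0 (sqrt s)"
  define J where "J x = integral {x - L..x + L} g" for x
  have cont: "continuous_on A g" for A
    unfolding g_def by (rule continuous_on_normal_density)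
  have int: "g integrable_on {a..b}" for a b
    by (intro integrable_continuous_real cont)
  have even: "g (- x) = g x" for x
    by (simp add: g_def normal_density_def)
  have J_minus: "J (- x) = J x" for x
    using Henstock_Kurzweil_Integration.integral_reflect_real[of "x + L" "x - L" g]
    by (simp add: J_def even)
  \<comment> \<open>Large enough for both ends of all intervals considered to lie strictly inside
    \<open>[-K, K]\<close>, where the fundamental theorem of calculus gives two-sided
    derivatives.\<close>
  define K where "K = \<bar>m'\<bar> + L + 1"
  have J_diff: "J x = integral {-K..x + L} g - integral {-K..x - L} g" if "0 \<le> x" "x \<le> \<bar>m'\<bar>" for x
    using Henstock_Kurzweil_Integration.integral_combine[of "-K" "x - L" "x + L" g] that int assms(1)
    by (auto simp: J_def K_def)
  have F: "((\<lambda>x. integral {-K..x} g) has_real_derivative g x) (at x)" if "-K < x" "x < K" for x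
  proof -
    have "((\<lambda>x. integral {-K..x} g) has_real_derivative g x) (at x within {-K..K})"
      using that by (intro integral_has_real_derivative cont) auto
    then show ?thesis
      using that by (simp add: at_within_Icc_at)
  qed
  have "integral {-K..\<bar>m'\<bar> + L} g - integral {-K..\<bar>m'\<bar> - L} g
      \<le> integral {-K..\<bar>m\<bar> + L} g - integral {-K..\<bar>m\<bar> - L} g"
  proof (rule DERIV_nonpos_imp_nonincreasing[OF assms(2)])
    fix x assume x: "\<bar>m\<bar> \<le> x" "x \<le> \<bar>m'\<bar>"
    have "((\<lambda>x. integral {-K..x + L} g - integral {-K..x - L} g) has_real_derivative
        (g (x + L) - g (x - L))) (at x)"
      using F[of "x + L"] F[of "x + - L"] x assms(1) unfolding DERIV_shift
      by (intro DERIV_diff) (auto simp: K_def)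
    moreover have "g (x + L) \<le> g (x - L)"
      using x assms by (simp add: g_def normal_density_def power2_eq_square field_simps)
    ultimately show "\<exists>y. ((\<lambda>x. integral {-K..x + L} g - integral {-K..x - L} g) has_real_derivative y) (at x) \<and> y \<le> 0"
      by (intro exI[of _ "g (x + L) - g (x - L)"]) auto
  qed
  then have "J \<bar>m'\<bar> \<le> J \<bar>m\<bar>"
    using J_diff assms(2) by simp
  then show ?thesis
    using J_minus[of m] J_minus[of m'] by (auto simp: J_def g_def abs_if split: if_splits)
qed

section \<open>Numerical estimates for variance 7\<close>

lemma pi_ge_3: "3 \<le> pi"
  using sin_x_le_x[of "pi / 6"] by (simp add: sin_30)

definition gauss_mass :: "real \<Rightarrow> real \<Rightarrow> real" where
  "gauss_mass a b = integral {a..b} (normal_density 0 (sqrt 7))"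

lemma gauss_mass_eq:
  "gauss_mass a b = integral {a..b} (\<lambda>x. exp (- x\<^sup>2 / 14)) / sqrt (14 * pi)"
proof -
  have "normal_density 0 (sqrt 7) = (\<lambda>x. 1 / sqrt (14 * pi) * exp (- x\<^sup>2 / 14))"
    by (simp add: normal_density_def fun_eq_iff mult.commute)
  then show ?thesis
    by (simp add: gauss_mass_def)
qed

text \<open>The factors are the worst-case chances that the components of a step along and across
  the base are suitable. With \<open>c = 1 / sqrt (14 * pi)\<close> the product is
  \<open>(A * c) * (1 - B * c)\<close>; eight Taylor terms give \<open>A \<ge> 4.13\<close>, five
  give \<open>B \<le> 5.17\<close>, and \<open>3 \<le> pi < 4\<close> locates \<open>c\<close> in
  \<open>[0.13, 0.1544]\<close>.\<close>

lemma success_probability_bound: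
  "1 / 8 \<le> gauss_mass (-1) (53 / 10) * (1 - gauss_mass (- (81 / 25)) (81 / 25))"
proof -
  have intg: "(\<lambda>x::real. exp (- x\<^sup>2 / 14)) integrable_on {a..b}" for a b
    by (intro integrable_continuous_real continuous_intros) auto
  define A where "A = integral {-1..53 / 10 :: real} (\<lambda>x. exp (- x\<^sup>2 / 14))"
  define B where "B = integral {- (81 / 25)..81 / 25 :: real} (\<lambda>x. exp (- x\<^sup>2 / 14))"
  define c where "c = 1 / sqrt (14 * pi)"
  have "integral {-1..53 / 10 :: real} (\<lambda>x. \<Sum>m<8. (- x\<^sup>2 / 14) ^ m / fact m) \<le> A"
    unfolding A_def by (intro integral_le intg has_integral_integrable[OF has_integral_gaussian_Taylor] exp_lower_Taylor_even) auto
  also have "integral {-1..53 / 10 :: real} (\<lambda>x. \<Sum>m<8. (- x\<^sup>2 / 14) ^ m / fact m) =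
    (\<Sum>m<8. (- 1 / 14) ^ m * ((53 / 10) ^ (2 * m + 1) - (-1) ^ (2 * m + 1)) / (fact m * (2 * real m + 1)))"
    by (rule integral_unique[OF has_integral_gaussian_Taylor]) simp
  also have "\<dots> \<ge> 413 / 100"
    by (simp add: eval_nat_numeral fact_numeral)
  finally have A: "413 / 100 \<le> A" by simp
  have "B \<le> integral {- (81 / 25)..81 / 25 :: real} (\<lambda>x. \<Sum>m<5. (- x\<^sup>2 / 14) ^ m / fact m)"
    unfolding B_def by (intro integral_le intg has_integral_integrable[OF has_integral_gaussian_Taylor] exp_upper_Taylor_odd) auto
  also have "\<dots> =
    (\<Sum>m<5. (- 1 / 14) ^ m * ((81 / 25) ^ (2 * m + 1) - (- (81 / 25)) ^ (2 * m + 1)) / (fact m * (2 * real m + 1)))"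
    by (rule integral_unique[OF has_integral_gaussian_Taylor]) simp
  also have "\<dots> \<le> 517 / 100"
    by (simp add: eval_nat_numeral fact_numeral)
  finally have B: "B \<le> 517 / 100" .
  have "sqrt (14 * pi) \<ge> 648 / 100"
    using pi_ge_3 by (intro real_le_rsqrt) (simp add: power2_eq_square)
  then have c1: "c \<le> 1544 / 10000" by (simp add: c_def field_simps)
  have "sqrt (14 * pi) \<le> 75 / 10"
    using pi_less_4 by (intro real_le_lsqrt) (auto simp: power2_eq_square)
  moreover have "0 < sqrt (14 * pi)" by simp
  ultimately have c0: "13 / 100 \<le> c" by (simp add: c_def field_simps)
  \<comment> \<open>This bounds \<open>c * c\<close> by its chord over
    \<open>[0.13, 0.1544]\<close>. The concave quadratic in \<open>c\<close> is then at least a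
    decreasing linear function, whose value at \<open>0.1544\<close> still exceeds
    \<open>1 / 8\<close>.\<close>
  have "0 \<le> (c - 13 / 100) * (1544 / 10000 - c)"
    using c0 c1 by (intro mult_nonneg_nonneg) auto
  moreover have "(c - 13 / 100) * (1544 / 10000 - c)
      = (13 / 100 + 1544 / 10000) * c - 13 / 100 * (1544 / 10000) - c * c"
    by (simp add: field_simps)
  moreover have "(413 / 100 * c) * (1 - 517 / 100 * c) = 413 / 100 * c - 213521 / 10000 * (c * c)"
    by (simp add: algebra_simps)
  ultimately have "1 / 8 \<le> (413 / 100 * c) * (1 - 517 / 100 * c)"
    using c1 by argo
  also have "\<dots> \<le> (A * c) * (1 - B * c)"
    using A B c0 c1 by (intro mult_mono mult_right_mono diff_left_mono mult_nonneg_nonneg) (auto intro: order_trans[OF mult_right_mono])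
  finally show ?thesis
    by (simp add: gauss_mass_eq A_def B_def c_def)
qed

section \<open>The normal law in the plane\<close>

text \<open>For \<open>c \<noteq> 0\<close> the rotation is a composition of two one-variable affine
  substitutions, first \<open>u = d * y + c * x\<close> for fixed \<open>y\<close>, then
  \<open>v = (y - d * u) / c\<close> for fixed \<open>u\<close>. Each brings in a factor
  \<open>\<bar>c\<bar>\<close>, on opposite sides of the equation. For \<open>c = 0\<close> the map
  is an exchange of coordinates up to sign.\<close>

lemma nn_integral_lborel_rotate:
  fixes f :: "real \<times> real \<Rightarrow> ennreal"
  assumes [measurable]: "f \<in> borel_measurable borel" and cd: "c\<^sup>2 + d\<^sup>2 = 1"
  shows "(\<integral>\<^sup>+z. f (c * fst z + d * snd z, c * snd z - d * fst z) \<partial>lborel) = (\<integral>\<^sup>+z. f z \<partial>lborel)"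
proof -
  have [measurable]: "f \<in> borel_measurable (borel \<Otimes>\<^sub>M borel)" by (simp add: borel_prod)
  have split: "(\<integral>\<^sup>+z. h z \<partial>lborel) = (\<integral>\<^sup>+x. \<integral>\<^sup>+y. h (x, y) \<partial>lborel \<partial>lborel)"
    if [measurable]: "h \<in> borel_measurable (borel \<Otimes>\<^sub>M borel)" for h :: "real \<times> real \<Rightarrow> ennreal"
    by (subst lborel_prod[symmetric], subst lborel.nn_integral_fst[symmetric]) auto
  have swap: "(\<integral>\<^sup>+x. \<integral>\<^sup>+y. h x y \<partial>lborel \<partial>lborel) = (\<integral>\<^sup>+y. \<integral>\<^sup>+x. h x y \<partial>lborel \<partial>lborel)"
    if [measurable]: "case_prod h \<in> borel_measurable (borel \<Otimes>\<^sub>M borel)" for h :: "real \<Rightarrow> real \<Rightarrow> ennreal"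
    using lborel_pair.Fubini'[of h] by simp
  have "(\<integral>\<^sup>+z. f (c * fst z + d * snd z, c * snd z - d * fst z) \<partial>lborel) =
      (\<integral>\<^sup>+x. \<integral>\<^sup>+y. f (c * x + d * y, c * y - d * x) \<partial>lborel \<partial>lborel)"
    using split[of "\<lambda>z. f (c * fst z + d * snd z, c * snd z - d * fst z)"] by simp
  also have "\<dots> = (\<integral>\<^sup>+x. \<integral>\<^sup>+y. f (x, y) \<partial>lborel \<partial>lborel)"
  proof (cases "c = 0")
    case True
    then have "d = 1 \<or> d = - 1" using cd by (simp add: power2_eq_1_iff)
    then have d: "d \<noteq> 0" "\<bar>d\<bar> = 1" by auto
    have "(\<integral>\<^sup>+x. \<integral>\<^sup>+y. f (c * x + d * y, c * y - d * x) \<partial>lborel \<partial>lborel) =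
        (\<integral>\<^sup>+x. \<integral>\<^sup>+y. f (0 + d * y, - d * x) \<partial>lborel \<partial>lborel)"
      by (simp add: True)
    also have "\<dots> = (\<integral>\<^sup>+x. \<integral>\<^sup>+y. f (y, - d * x) \<partial>lborel \<partial>lborel)"
    proof (rule nn_integral_cong)
      fix x
      show "(\<integral>\<^sup>+y. f (0 + d * y, - d * x) \<partial>lborel) = (\<integral>\<^sup>+y. f (y, - d * x) \<partial>lborel)"
        using d nn_integral_real_affine[of "\<lambda>y. f (y, - d * x)" d 0] by simp
    qed
    also have "\<dots> = (\<integral>\<^sup>+y. \<integral>\<^sup>+x. f (y, 0 + - d * x) \<partial>lborel \<partial>lborel)"
      by (simp, rule swap) measurable
    also have "\<dots> = (\<integral>\<^sup>+y. \<integral>\<^sup>+x. f (y, x) \<partial>lborel \<partial>lborel)"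
    proof (rule nn_integral_cong)
      fix y
      show "(\<integral>\<^sup>+x. f (y, 0 + - d * x) \<partial>lborel) = (\<integral>\<^sup>+x. f (y, x) \<partial>lborel)"
        using d nn_integral_real_affine[of "\<lambda>x. f (y, x)" "- d" 0] by simp
    qed
    finally show ?thesis .
  next
    case False
    \<comment> \<open>By \<open>c\<^sup>2 + d\<^sup>2 = 1\<close> the second coordinate is a
      function of \<open>y\<close> and of the first coordinate alone.\<close>
    have *: "f (c * x + d * y, c * y - d * x) = f (d * y + c * x, (y - d * (d * y + c * x)) / c)" for x y
    proof -
      have "y - d * (d * y + c * x) = (c\<^sup>2 + d\<^sup>2) * y - d * (d * y + c * x)" using cd by simp
      also have "\<dots> = c * (c * y - d * x)" by (simp add: algebra_simps power2_eq_square)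
      finally have "(y - d * (d * y + c * x)) / c = c * y - d * x" using False by simp
      then show ?thesis by (simp add: add.commute)
    qed
    have "ennreal \<bar>c\<bar> * (\<integral>\<^sup>+x. \<integral>\<^sup>+y. f (c * x + d * y, c * y - d * x) \<partial>lborel \<partial>lborel) =
      ennreal \<bar>c\<bar> * (\<integral>\<^sup>+y. \<integral>\<^sup>+x. f (c * x + d * y, c * y - d * x) \<partial>lborel \<partial>lborel)"
      by (intro arg_cong[where f="(*) (ennreal \<bar>c\<bar>)"] swap) measurable
    also have "\<dots> = (\<integral>\<^sup>+y. ennreal \<bar>c\<bar> * (\<integral>\<^sup>+x. f (d * y + c * x, (y - d * (d * y + c * x)) / c) \<partial>lborel) \<partial>lborel)"
      unfolding * by (rule nn_integral_cmult[symmetric]) measurable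
    also have "\<dots> = (\<integral>\<^sup>+y. \<integral>\<^sup>+u. f (u, (y - d * u) / c) \<partial>lborel \<partial>lborel)"
    proof (rule nn_integral_cong)
      fix y
      show "ennreal \<bar>c\<bar> * (\<integral>\<^sup>+x. f (d * y + c * x, (y - d * (d * y + c * x)) / c) \<partial>lborel)
          = (\<integral>\<^sup>+u. f (u, (y - d * u) / c) \<partial>lborel)"
        by (rule nn_integral_real_affine[OF _ False, symmetric]) auto
    qed
    also have "\<dots> = (\<integral>\<^sup>+u. \<integral>\<^sup>+y. f (u, - (d * u / c) + (1 / c) * y) \<partial>lborel \<partial>lborel)"
      unfolding diff_divide_distrib by (simp, rule swap) measurable
    also have "\<dots> = (\<integral>\<^sup>+u. ennreal \<bar>c\<bar> * (\<integral>\<^sup>+v. f (u, v) \<partial>lborel) \<partial>lborel)"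
    proof (rule nn_integral_cong)
      fix u
      have "(\<integral>\<^sup>+v. f (u, v) \<partial>lborel) = ennreal \<bar>1 / c\<bar> * (\<integral>\<^sup>+y. f (u, - (d * u / c) + (1 / c) * y) \<partial>lborel)"
        using False by (intro nn_integral_real_affine) auto
      then have "ennreal \<bar>c\<bar> * (\<integral>\<^sup>+v. f (u, v) \<partial>lborel) =
         (ennreal \<bar>c\<bar> * ennreal \<bar>1 / c\<bar>) * (\<integral>\<^sup>+y. f (u, - (d * u / c) + (1 / c) * y) \<partial>lborel)"
        by (simp add: mult.assoc)
      also have "ennreal \<bar>c\<bar> * ennreal \<bar>1 / c\<bar> = 1"
        using False by (simp flip: ennreal_mult)
      finally show "(\<integral>\<^sup>+y. f (u, - (d * u / c) + (1 / c) * y) \<partial>lborel) = ennreal \<bar>c\<bar> * (\<integral>\<^sup>+v. f (u, v) \<partial>lborel)"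
        by simp
    qed
    also have "\<dots> = ennreal \<bar>c\<bar> * (\<integral>\<^sup>+u. \<integral>\<^sup>+v. f (u, v) \<partial>lborel \<partial>lborel)"
      by (rule nn_integral_cmult) measurable
    finally show ?thesis
      using False by (simp add: ennreal_mult_cancel_left)
  qed
  also have "\<dots> = (\<integral>\<^sup>+z. f z \<partial>lborel)"
    by (rule split[symmetric]) measurable
  finally show ?thesis .
qed

abbreviation planar_normal_law :: "real \<Rightarrow> (real \<times> real) measure" where
  "planar_normal_law s \<equiv> normal_law s \<Otimes>\<^sub>M normal_law s"

text \<open>The density is a function of the norm only, which is the source of both the rotation
  invariance and the explicit radial tail.\<close>

lemma planar_normal_law_density:
  assumes "0 < s"
  shows "planar_normal_law s = density lborel (\<lambda>z. ennreal (exp (- (norm z)\<^sup>2 / (2 * s)) / (2 * pi * s)))"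
proof -
  interpret prob_space "normal_law s" by (rule prob_space_normal_law[OF assms])
  have "planar_normal_law s = density (lborel \<Otimes>\<^sub>M lborel)
      (\<lambda>(x, y). ennreal (normal_density 0 (sqrt s) x) * ennreal (normal_density 0 (sqrt s) y))"
    by (intro pair_measure_density) (auto intro: lborel.sigma_finite_measure_axioms sigma_finite_measure_axioms)
  also have "(\<lambda>(x, y). ennreal (normal_density 0 (sqrt s) x) * ennreal (normal_density 0 (sqrt s) y))
      = (\<lambda>z. ennreal (exp (- (norm z)\<^sup>2 / (2 * s)) / (2 * pi * s)))"
    using assms
    by (auto simp: fun_eq_iff normal_density_def norm_Pair exp_add[symmetric] add_divide_distrib
          simp flip: ennreal_mult)
  finally show ?thesis by (simp add: lborel_prod)
qed

lemma emeasure_planar_normal_law_rotate: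
  assumes "0 < s" "c\<^sup>2 + d\<^sup>2 = 1" and [measurable]: "A \<in> sets borel"
  shows "emeasure (planar_normal_law s) {z. (c * fst z + d * snd z, c * snd z - d * fst z) \<in> A}
       = emeasure (planar_normal_law s) A"
proof -
  define f where "f z = ennreal (exp (- (norm z)\<^sup>2 / (2 * s)) / (2 * pi * s)) * indicator A z" for z :: "real \<times> real"
  have norm_eq: "(norm (c * x + d * y, c * y - d * x))\<^sup>2 = (norm (x, y))\<^sup>2" for x y
  proof -
    have "(c * x + d * y)\<^sup>2 + (c * y - d * x)\<^sup>2 = (c\<^sup>2 + d\<^sup>2) * (x\<^sup>2 + y\<^sup>2)"
      by (simp add: power2_eq_square algebra_simps)
    then show ?thesis using assms(2) by (simp add: norm_Pair)
  qed
  have "(\<lambda>z. (c * fst z + d * snd z, c * snd z - d * fst z)) \<in> borel \<rightarrow>\<^sub>M borel"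
    by (intro borel_measurable_continuous_onI continuous_intros)
  from measurable_sets[OF this assms(3)]
  have [measurable]: "{z. (c * fst z + d * snd z, c * snd z - d * fst z) \<in> A} \<in> sets borel"
    by (simp add: vimage_def)
  have "emeasure (planar_normal_law s) {z. (c * fst z + d * snd z, c * snd z - d * fst z) \<in> A}
      = (\<integral>\<^sup>+z. f (c * fst z + d * snd z, c * snd z - d * fst z) \<partial>lborel)"
    unfolding planar_normal_law_density[OF assms(1)] f_def
    by (subst emeasure_density) (auto simp: norm_eq indicator_def intro!: nn_integral_cong)
  also have "\<dots> = (\<integral>\<^sup>+z. f z \<partial>lborel)"
    using assms by (intro nn_integral_lborel_rotate) (auto simp: f_def)
  also have "\<dots> = emeasure (planar_normal_law s) A"
    unfolding planar_normal_law_density[OF assms(1)] f_def by (subst emeasure_density) auto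
  finally show ?thesis .
qed

text \<open>A layer-cake argument in place of polar coordinates: the Gaussian factor is written as
  the integral of \<open>k\<close> over \<open>[norm z, \<infinity>)\<close>. After exchanging the
  integrals only areas of annuli remain, and the last integral has an explicit
  antiderivative.\<close>

lemma emeasure_planar_normal_law_radial:
  assumes s: "0 < s" and a: "0 \<le> a"
  shows "emeasure (planar_normal_law s) {z. a \<le> norm z} = ennreal (exp (- a\<^sup>2 / (2 * s)))"
proof -
  \<comment> \<open>Minus the derivative of \<open>exp (- r\<^sup>2 / (2 * s))\<close>.\<close>
  define k where "k r = r / s * exp (- r\<^sup>2 / (2 * s))" for r :: real
  have [measurable]: "k \<in> borel_measurable borel" by (simp add: k_def[abs_def])
  have k_nonneg: "0 \<le> r \<Longrightarrow> 0 \<le> k r" for r using s by (simp add: k_def)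
  have tail: "(\<integral>\<^sup>+r. ennreal (k r) * indicator {b..} r \<partial>lborel) = ennreal (exp (- b\<^sup>2 / (2 * s)))"
    if "0 \<le> b" for b
  proof -
    have "(\<integral>\<^sup>+r. ennreal (k r) * indicator {b..} r \<partial>lborel) = ennreal (0 - - exp (- b\<^sup>2 / (2 * s)))"
    proof (rule nn_integral_FTC_atLeast[where F="\<lambda>r. - exp (- r\<^sup>2 / (2 * s))"])
      show "((\<lambda>r. - exp (- r\<^sup>2 / (2 * s))) \<longlongrightarrow> 0) at_top"
        using s by real_asymp
      show "DERIV (\<lambda>r. - exp (- r\<^sup>2 / (2 * s))) r :> k r" for r
        using s by (auto intro!: derivative_eq_intros simp: k_def)
    qed (use that k_nonneg in auto)
    then show ?thesis by simp
  qed
  have "emeasure (planar_normal_law s) {z. a \<le> norm z}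
      = (\<integral>\<^sup>+z. ennreal (exp (- (norm z)\<^sup>2 / (2 * s)) / (2 * pi * s)) * indicator {z :: real \<times> real. a \<le> norm z} z \<partial>lborel)"
    unfolding planar_normal_law_density[OF s] by (subst emeasure_density) auto
  also have "\<dots> = (\<integral>\<^sup>+z. \<integral>\<^sup>+r. ennreal (1 / (2 * pi * s)) * ennreal (k r) *
      (indicator {a..} r * indicator {z :: real \<times> real. a \<le> norm z \<and> norm z \<le> r} z) \<partial>lborel \<partial>lborel)"
  proof (rule nn_integral_cong)
    fix z :: "real \<times> real"
    have "(\<integral>\<^sup>+r. ennreal (1 / (2 * pi * s)) * ennreal (k r) *
      (indicator {a..} r * indicator {z :: real \<times> real. a \<le> norm z \<and> norm z \<le> r} z) \<partial>lborel)
      = (\<integral>\<^sup>+r. (ennreal (1 / (2 * pi * s)) * indicator {z. a \<le> norm z} z) * (ennreal (k r) * indicator {norm z..} r) \<partial>lborel)"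
      by (intro nn_integral_cong) (auto simp: indicator_def)
    also have "\<dots> = ennreal (1 / (2 * pi * s)) * indicator {z. a \<le> norm z} z * ennreal (exp (- (norm z)\<^sup>2 / (2 * s)))"
      by (subst nn_integral_cmult) (auto simp: tail)
    also have "\<dots> = ennreal (exp (- (norm z)\<^sup>2 / (2 * s)) / (2 * pi * s)) * indicator {z. a \<le> norm z} z"
      using s by (auto simp: indicator_def simp flip: ennreal_mult)
    finally show "ennreal (exp (- (norm z)\<^sup>2 / (2 * s)) / (2 * pi * s)) * indicator {z. a \<le> norm z} z =
      (\<integral>\<^sup>+r. ennreal (1 / (2 * pi * s)) * ennreal (k r) *
      (indicator {a..} r * indicator {z :: real \<times> real. a \<le> norm z \<and> norm z \<le> r} z) \<partial>lborel)" by simp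
  qed
  also have "\<dots> = (\<integral>\<^sup>+r. \<integral>\<^sup>+z. ennreal (1 / (2 * pi * s)) * ennreal (k r) *
      (indicator {a..} r * indicator {z :: real \<times> real. a \<le> norm z \<and> norm z \<le> r} z) \<partial>lborel \<partial>lborel)"
    by (rule lborel_pair.Fubini'[symmetric]) measurable
  also have "\<dots> = (\<integral>\<^sup>+r. ennreal (k r * (r\<^sup>2 - a\<^sup>2) / (2 * s)) * indicator {a..} r \<partial>lborel)"
  proof (rule nn_integral_cong)
    fix r
    have "(\<integral>\<^sup>+z. ennreal (1 / (2 * pi * s)) * ennreal (k r) *
      (indicator {a..} r * indicator {z :: real \<times> real. a \<le> norm z \<and> norm z \<le> r} z) \<partial>lborel)
      = ennreal (1 / (2 * pi * s)) * ennreal (k r) * indicator {a..} r *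
        emeasure lborel {z :: real \<times> real. a \<le> norm z \<and> norm z \<le> r}"
      unfolding mult.assoc[symmetric] by (rule nn_integral_cmult_indicator) measurable
    also have "\<dots> = ennreal (k r * (r\<^sup>2 - a\<^sup>2) / (2 * s)) * indicator {a..} r"
    proof (cases "a \<le> r")
      case True
      have "{z :: real \<times> real. a \<le> norm z \<and> norm z \<le> r} = cball 0 r - ball 0 a" by auto
      also have "emeasure lborel \<dots> = emeasure lborel (cball 0 r :: (real \<times> real) set) - emeasure lborel (ball 0 a :: (real \<times> real) set)"
        using True a by (intro emeasure_Diff) (auto simp: emeasure_ball)
      also have "\<dots> = ennreal (pi * (r\<^sup>2 - a\<^sup>2))"
        using True a by (simp add: emeasure_cball emeasure_ball unit_ball_vol_2 ennreal_minus right_diff_distrib power2_eq_square)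
      finally show ?thesis
        using True a s k_nonneg[of r] by (simp add: power_mono flip: ennreal_mult)
    qed auto
    finally show "(\<integral>\<^sup>+z. ennreal (1 / (2 * pi * s)) * ennreal (k r) *
      (indicator {a..} r * indicator {z :: real \<times> real. a \<le> norm z \<and> norm z \<le> r} z) \<partial>lborel)
      = ennreal (k r * (r\<^sup>2 - a\<^sup>2) / (2 * s)) * indicator {a..} r" .
  qed
  also have "\<dots> = ennreal (0 - - ((a\<^sup>2 - a\<^sup>2 + 2 * s) / (2 * s) * exp (- a\<^sup>2 / (2 * s))))"
  proof (rule nn_integral_FTC_atLeast[where F="\<lambda>r. - ((r\<^sup>2 - a\<^sup>2 + 2 * s) / (2 * s) * exp (- r\<^sup>2 / (2 * s)))"])
    show "((\<lambda>r. - ((r\<^sup>2 - a\<^sup>2 + 2 * s) / (2 * s) * exp (- r\<^sup>2 / (2 * s)))) \<longlongrightarrow> 0) at_top"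
      using s by real_asymp
    show "DERIV (\<lambda>r. - ((r\<^sup>2 - a\<^sup>2 + 2 * s) / (2 * s) * exp (- r\<^sup>2 / (2 * s)))) r :> k r * (r\<^sup>2 - a\<^sup>2) / (2 * s)" for r
      using s by (auto intro!: derivative_eq_intros simp: k_def field_simps power2_eq_square)
    show "0 \<le> k r * (r\<^sup>2 - a\<^sup>2) / (2 * s)" if "a \<le> r" for r
      using that a s k_nonneg[of r] by (intro divide_nonneg_nonneg mult_nonneg_nonneg) (auto intro: power_mono)
  qed auto
  finally show ?thesis using s by simp
qed

section \<open>One-step probabilities of the planar walk\<close>

lemma prob_space_planar_normal_law:
  "0 < s \<Longrightarrow> prob_space (planar_normal_law s)"
  by (intro prob_space_pair prob_space_normal_law)

text \<open>The radial tail at \<open>4.3\<close> is \<open>exp (- 1849 / 1400)\<close>, and eight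
  Taylor terms show that it is at least \<open>0.26\<close>.\<close>

lemma emeasure_short_step:
  "emeasure (planar_normal_law 7) {x. norm x < 43 / 10} \<le> ennreal (37 / 50)"
proof -
  interpret prob_space "planar_normal_law 7" by (rule prob_space_planar_normal_law) simp
  have eq: "space (planar_normal_law 7) - {x. 43 / 10 \<le> norm x} = {x. norm x < 43 / 10}"
    by (auto simp: space_pair_measure)
  have sets: "{x. 43 / 10 \<le> norm x} \<in> sets (planar_normal_law 7)"
    by (simp only: planar_normal_law_density[of 7] zero_less_numeral sets_density) simp
  have "(\<Sum>m<8. (- 1849 / 1400) ^ m / fact m) \<le> exp (- 1849 / 1400 :: real)"
    by (rule exp_lower_Taylor_even) simp
  also have "(\<Sum>m<8. (- 1849 / 1400) ^ m / fact m) \<ge> (13 / 50 :: real)"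
    by (simp add: eval_nat_numeral fact_numeral)
  finally have "13 / 50 \<le> exp (- 1849 / 1400 :: real)" .
  moreover have "measure (planar_normal_law 7) {x. 43 / 10 \<le> norm x} = exp (- 1849 / 1400)"
  proof -
    have e: "- 1849 / 1400 = - (43 / 10)\<^sup>2 / (2 * 7 :: real)" by (simp add: power2_eq_square)
    show ?thesis
      unfolding measure_def e by (subst emeasure_planar_normal_law_radial) auto
  qed
  ultimately have "measure (planar_normal_law 7) {x. norm x < 43 / 10} \<le> 37 / 50"
    using prob_compl[OF sets] unfolding eq by simp
  then show ?thesis
    unfolding emeasure_eq_measure by (rule ennreal_leI)
qed

definition complex_of_pair :: "real \<times> real \<Rightarrow> complex" where
  "complex_of_pair z = Complex (fst z) (snd z)"

lemma complex_of_pair_simps [simp]: "Re (complex_of_pair z) = fst z" "Im (complex_of_pair z) = snd z" "norm (complex_of_pair z) = norm z"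
  by (simp_all add: complex_of_pair_def cmod_def norm_prod_def)

text \<open>In the frame of the base the components of the step are independent centred normals.
  Success is guaranteed when the first lies in \<open>I\<close> and the second in \<open>J\<close>.
  The least favourable foot for \<open>I\<close> is an end of the base, and the complement of
  \<open>J\<close> is heaviest when centred at zero, so the chance of success is at least the
  product in \<open>success_probability_bound\<close>.\<close>

lemma emeasure_no_wide_triangle:
  assumes "43 / 10 \<le> norm (Q - P)" and foot: "0 \<le> Re (cnj (Q - P) * (Z - P))"
    "Re (cnj (Q - P) * (Z - P)) \<le> (norm (Q - P))\<^sup>2"
  shows "emeasure (planar_normal_law 7) {x. \<not> wide_triangle P Q (Z + complex_of_pair x)} \<le> ennreal (7 / 8)"
proof -
  interpret N: prob_space "normal_law 7" by (rule prob_space_normal_law) simp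
  interpret prob_space "planar_normal_law 7" by (rule prob_space_planar_normal_law) simp
  define R where "R = norm (Q - P)"
  define c where "c = Re (Q - P) / R"
  define d where "d = Im (Q - P) / R"
  define \<phi> where "\<phi> = Re (cnj (Q - P) * (Z - P)) / R"
  define \<eta> where "\<eta> = Im (cnj (Q - P) * (Z - P)) / R"
  \<comment> \<open>The admissible window \<open>[- 1 - \<phi>, R + 1 - \<phi>]\<close> contains the
    interval \<open>I\<close> of length \<open>6.3\<close>, and
    \<open>0 \<le> \<tau> \<le> 4.3\<close> keeps the centre \<open>2.15 - \<tau>\<close> of
    \<open>I\<close> within \<open>2.15\<close> of zero.\<close>
  define \<tau> where "\<tau> = min \<phi> (43 / 10)"
  define I where "I = {- 1 - \<tau> .. 53 / 10 - \<tau>}"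
  define J where "J = {v. 81 / 25 \<le> \<bar>\<eta> + v\<bar>}"
  define T where "T = (\<lambda>z. (c * fst z + d * snd z, c * snd z - d * fst z))"
  have R: "43 / 10 \<le> R" using assms by (simp add: R_def)
  have cd: "c\<^sup>2 + d\<^sup>2 = 1"
    using R unfolding c_def d_def power_divide add_divide_distrib[symmetric] cmod_power2[symmetric] R_def
    by auto
  have "Re (cnj (Q - P) * (Z - P)) \<le> R * R"
    using foot(2) unfolding R_def power2_eq_square .
  then have "\<phi> \<le> R"
    unfolding \<phi>_def using R by (intro pos_divide_le_eq[THEN iffD2]) linarith+
  moreover have "0 \<le> \<phi>"
    unfolding \<phi>_def by (intro divide_nonneg_nonneg foot(1)) (use R in linarith)
  ultimately have \<phi>: "0 \<le> \<phi>" "\<phi> \<le> R" by auto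
  have \<tau>: "0 \<le> \<tau>" "\<tau> \<le> 43 / 10" "\<tau> \<le> \<phi>" "43 / 10 - \<tau> \<le> R - \<phi>"
    using \<phi> R by (auto simp: \<tau>_def)
  have wide: "wide_triangle P Q (Z + complex_of_pair x)" if "T x \<in> I \<times> J" for x
  proof -
    have D: "Re (Q - P) = R * c" "Im (Q - P) = R * d" using R by (auto simp: c_def d_def)
    have ZP: "cnj (Q - P) * (Z - P) = Complex (R * \<phi>) (R * \<eta>)"
      using R by (simp add: \<phi>_def \<eta>_def complex_eq_iff)
    have "cnj (Q - P) * complex_of_pair x = Complex (R * fst (T x)) (R * snd (T x))"
    proof -
      have "Re (cnj (Q - P) * complex_of_pair x) = Re (Q - P) * fst x + Im (Q - P) * snd x"
        "Im (cnj (Q - P) * complex_of_pair x) = Re (Q - P) * snd x - Im (Q - P) * fst x"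
        by (simp_all add: algebra_simps)
      then show ?thesis
        unfolding D complex_eq_iff by (simp add: T_def algebra_simps)
    qed
    then have "cnj (Q - P) * (Z + complex_of_pair x - P) = Complex (R * (\<phi> + fst (T x))) (R * (\<eta> + snd (T x)))"
    proof -
      have "cnj (Q - P) * (Z + complex_of_pair x - P) = cnj (Q - P) * (Z - P) + cnj (Q - P) * complex_of_pair x"
        by (simp add: algebra_simps)
      then show ?thesis
        using ZP \<open>cnj (Q - P) * complex_of_pair x = _\<close> by (simp only: complex_add distrib_left)
    qed
    moreover have "- 1 \<le> \<phi> + fst (T x)" "\<phi> + fst (T x) \<le> R + 1" "81 / 25 \<le> \<bar>\<eta> + snd (T x)\<bar>"
      using that \<tau> by (auto simp: I_def J_def)
    moreover have "- R \<le> R * (\<phi> + fst (T x))"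
      using mult_left_mono[of "- 1" "\<phi> + fst (T x)" R] calculation R by simp
    moreover have "R * (\<phi> + fst (T x)) \<le> R\<^sup>2 + R"
      using mult_left_mono[of "\<phi> + fst (T x)" "R + 1" R] calculation R by (simp add: power2_eq_square algebra_simps)
    moreover have "81 / 25 * R \<le> \<bar>R * (\<eta> + snd (T x))\<bar>"
      using mult_left_mono[of "81 / 25" "\<bar>\<eta> + snd (T x)\<bar>" R] calculation R by (simp add: abs_mult)
    ultimately show ?thesis
      using R unfolding wide_triangle_def R_def[symmetric] by simp
  qed
  have [measurable]: "I \<in> sets borel" "J \<in> sets borel" by (auto simp: I_def J_def)
  have measT: "{x. T x \<in> I \<times> J} \<in> sets (planar_normal_law 7)"
  proof -
    have "T \<in> borel \<rightarrow>\<^sub>M borel"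
      unfolding T_def by (intro borel_measurable_continuous_onI continuous_intros)
    moreover have "I \<times> J \<in> sets borel" by (simp add: borel_prod[symmetric])
    ultimately have "T -` (I \<times> J) \<inter> space borel \<in> sets borel" by (rule measurable_sets)
    then show ?thesis unfolding planar_normal_law_density[OF zero_less_numeral] by (simp add: vimage_def)
  qed
  have "emeasure (planar_normal_law 7) {x. T x \<in> I \<times> J} = emeasure (planar_normal_law 7) (I \<times> J)"
    unfolding T_def using cd by (intro emeasure_planar_normal_law_rotate) (auto simp: borel_prod[symmetric])
  also have "\<dots> = emeasure (normal_law 7) I * emeasure (normal_law 7) J"
    by (rule N.emeasure_pair_measure_Times) auto
  finally have prod: "measure (planar_normal_law 7) {x. T x \<in> I \<times> J} = measure (normal_law 7) I * measure (normal_law 7) J"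
    by (simp add: measure_def enn2real_mult)
  have I_mass: "gauss_mass (- 1) (53 / 10) \<le> measure (normal_law 7) I"
  proof -
    have "measure (normal_law 7) I = gauss_mass (43 / 20 - \<tau> - 63 / 20) (43 / 20 - \<tau> + 63 / 20)"
      by (simp add: I_def measure_def emeasure_normal_law_Icc gauss_mass_def integral_nonneg algebra_simps
         Henstock_Kurzweil_Integration.integral_nonneg integrable_continuous_real continuous_on_normal_density)
    also have "\<dots> \<ge> gauss_mass (43 / 20 - 63 / 20) (43 / 20 + 63 / 20)"
      unfolding gauss_mass_def
    proof (rule normal_Icc_mono_centre)
      show "\<bar>43 / 20 - \<tau>\<bar> \<le> \<bar>43 / 20\<bar>"
        using \<tau>(1,2) unfolding abs_real_def by auto
    qed simp_all
    finally show ?thesis by simp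
  qed
  have J_mass: "1 - gauss_mass (- (81 / 25)) (81 / 25) \<le> measure (normal_law 7) J"
  proof -
    have "measure (normal_law 7) {- \<eta> - 81 / 25.. - \<eta> + 81 / 25} = gauss_mass (- \<eta> - 81 / 25) (- \<eta> + 81 / 25)"
      by (simp add: measure_def emeasure_normal_law_Icc gauss_mass_def
         Henstock_Kurzweil_Integration.integral_nonneg integrable_continuous_real continuous_on_normal_density)
    also have "\<dots> \<le> gauss_mass (0 - 81 / 25) (0 + 81 / 25)"
      unfolding gauss_mass_def by (intro normal_Icc_mono_centre) auto
    finally have "1 - gauss_mass (- (81 / 25)) (81 / 25) \<le> 1 - measure (normal_law 7) {- \<eta> - 81 / 25.. - \<eta> + 81 / 25}"
      by simp
    also have "\<dots> = measure (normal_law 7) (space (normal_law 7) - {- \<eta> - 81 / 25.. - \<eta> + 81 / 25})"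
      by (rule N.prob_compl[symmetric]) simp
    also have "\<dots> \<le> measure (normal_law 7) J"
      by (rule N.finite_measure_mono) (auto simp: J_def abs_if)
    finally show ?thesis .
  qed
  have "gauss_mass (- 1) (53 / 10) \<ge> 0"
    unfolding gauss_mass_def
    by (intro Henstock_Kurzweil_Integration.integral_nonneg integrable_continuous_real continuous_on_normal_density) auto
  then have "gauss_mass (- 1) (53 / 10) * (1 - gauss_mass (- (81 / 25)) (81 / 25))
      \<le> measure (normal_law 7) I * measure (normal_law 7) J"
    using I_mass J_mass by (smt (verit) measure_nonneg mult_mono mult_left_mono)
  then have "1 / 8 \<le> measure (planar_normal_law 7) {x. T x \<in> I \<times> J}"
    using success_probability_bound prod by simp
  then have "measure (planar_normal_law 7) (space (planar_normal_law 7) - {x. T x \<in> I \<times> J}) \<le> 7 / 8"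
    using prob_compl[OF measT] by simp
  moreover have "emeasure (planar_normal_law 7) {x. \<not> wide_triangle P Q (Z + complex_of_pair x)}
     \<le> emeasure (planar_normal_law 7) (space (planar_normal_law 7) - {x. T x \<in> I \<times> J})"
  proof (rule emeasure_mono)
    show "space (planar_normal_law 7) - {x. T x \<in> I \<times> J} \<in> sets (planar_normal_law 7)"
      by (intro sets.Diff sets.top measT)
    show "{x. \<not> wide_triangle P Q (Z + complex_of_pair x)} \<subseteq> space (planar_normal_law 7) - {x. T x \<in> I \<times> J}"
      using wide by (auto simp: space_pair_measure)
  qed
  ultimately show ?thesis
    unfolding emeasure_eq_measure by (meson ennreal_leI order_trans)
qed

section \<open>Independence and iterated updates\<close>

text \<open>State \<open>n\<close> reads only the inputs \<open>0, ..., n - 1\<close>; for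
  independent inputs it is therefore independent of input \<open>n\<close>.\<close>

primrec iterates :: "('s \<Rightarrow> 'b \<Rightarrow> 's) \<Rightarrow> 's \<Rightarrow> (nat \<Rightarrow> 'b) \<Rightarrow> nat \<Rightarrow> 's" where
  "iterates u s \<xi> 0 = s"
| "iterates u s \<xi> (Suc n) = u (iterates u s \<xi> n) (\<xi> n)"

lemma iterates_cong: "(\<And>i. i < n \<Longrightarrow> \<xi> i = \<zeta> i) \<Longrightarrow> iterates u s \<xi> n = iterates u s \<zeta> n"
  by (induction n) auto

lemma measurable_iterates:
  fixes s :: "'s :: topological_space"
  assumes u: "case_prod u \<in> borel \<Otimes>\<^sub>M borel \<rightarrow>\<^sub>M borel" and "n \<le> m"
  shows "(\<lambda>\<xi>. iterates u s \<xi> n) \<in> PiM {..<m} (\<lambda>_. borel) \<rightarrow>\<^sub>M borel"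
  using \<open>n \<le> m\<close>
proof (induction n)
  case 0
  show ?case unfolding iterates.simps by (rule measurable_const) simp
next
  case (Suc n)
  have IH: "(\<lambda>\<xi>. iterates u s \<xi> n) \<in> PiM {..<m} (\<lambda>_. borel) \<rightarrow>\<^sub>M borel"
    using Suc by simp
  have "(\<lambda>\<xi>. \<xi> n) \<in> PiM {..<m} (\<lambda>_. borel) \<rightarrow>\<^sub>M borel"
    using Suc.prems by (intro measurable_component_singleton) auto
  from measurable_compose[OF measurable_Pair[OF IH this] u]
  show ?case unfolding iterates.simps prod.case .
qed

text \<open>The library's \<open>indep_var\<close> requires both variables to have values in the same type.\<close>
definition (in prob_space) indep_pair :: "'b measure \<Rightarrow> ('a \<Rightarrow> 'b) \<Rightarrow> 'c measure \<Rightarrow> ('a \<Rightarrow> 'c) \<Rightarrow> bool" where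
  "indep_pair S A T B \<longleftrightarrow> A \<in> M \<rightarrow>\<^sub>M S \<and> B \<in> M \<rightarrow>\<^sub>M T \<and>
     distr M (S \<Otimes>\<^sub>M T) (\<lambda>\<omega>. (A \<omega>, B \<omega>)) = distr M S A \<Otimes>\<^sub>M distr M T B"

context prob_space
begin

lemma indep_var_imp_indep_pair: "indep_var S A T B \<Longrightarrow> indep_pair S A T B"
  by (simp add: indep_pair_def indep_var_distribution_eq)

lemma indep_pair_compose:
  assumes AB: "indep_pair S A T B" and f: "f \<in> S \<rightarrow>\<^sub>M S'" and g: "g \<in> T \<rightarrow>\<^sub>M T'"
  shows "indep_pair S' (\<lambda>\<omega>. f (A \<omega>)) T' (\<lambda>\<omega>. g (B \<omega>))"
proof -
  have A: "A \<in> M \<rightarrow>\<^sub>M S" and B: "B \<in> M \<rightarrow>\<^sub>M T"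
    and eq: "distr M (S \<Otimes>\<^sub>M T) (\<lambda>\<omega>. (A \<omega>, B \<omega>)) = distr M S A \<Otimes>\<^sub>M distr M T B"
    using AB by (auto simp: indep_pair_def)
  have fA: "(\<lambda>\<omega>. f (A \<omega>)) \<in> M \<rightarrow>\<^sub>M S'" and gB: "(\<lambda>\<omega>. g (B \<omega>)) \<in> M \<rightarrow>\<^sub>M T'"
    using measurable_compose[OF A f] measurable_compose[OF B g] by auto
  have dist: "distr M S' (\<lambda>\<omega>. f (A \<omega>)) = distr (distr M S A) S' f"
    "distr M T' (\<lambda>\<omega>. g (B \<omega>)) = distr (distr M T B) T' g"
    using A B f g by (simp_all add: distr_distr comp_def)
  have "sigma_finite_measure (distr (distr M T B) T' g)"
    unfolding dist(2)[symmetric]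
    by (intro prob_space_imp_sigma_finite prob_space_distr gB)
  then have "distr M S' (\<lambda>\<omega>. f (A \<omega>)) \<Otimes>\<^sub>M distr M T' (\<lambda>\<omega>. g (B \<omega>))
     = distr (distr M S A \<Otimes>\<^sub>M distr M T B) (S' \<Otimes>\<^sub>M T') (\<lambda>(x, y). (f x, g y))"
    unfolding dist using f g by (intro pair_measure_distr) simp_all
  also have "\<dots> = distr M (S' \<Otimes>\<^sub>M T') ((\<lambda>(x, y). (f x, g y)) \<circ> (\<lambda>\<omega>. (A \<omega>, B \<omega>)))"
    unfolding eq[symmetric]
    by (intro distr_distr) (use A B f g in \<open>simp_all add: split_beta\<close>)
  finally show ?thesis
    using fA gB by (simp add: indep_pair_def comp_def)
qed

text \<open>Tonelli for the product law: \<open>B\<close> may be integrated out with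
  \<open>A\<close> frozen.\<close>

lemma nn_integral_indep_pair:
  assumes ind: "indep_pair S A T B" and f: "f \<in> borel_measurable (S \<Otimes>\<^sub>M T)"
  shows "(\<integral>\<^sup>+\<omega>. f (A \<omega>, B \<omega>) \<partial>M) = (\<integral>\<^sup>+\<omega>. (\<integral>\<^sup>+y. f (A \<omega>, y) \<partial>distr M T B) \<partial>M)"
proof -
  have rv: "A \<in> M \<rightarrow>\<^sub>M S" "B \<in> M \<rightarrow>\<^sub>M T"
    and eq: "distr M S A \<Otimes>\<^sub>M distr M T B = distr M (S \<Otimes>\<^sub>M T) (\<lambda>\<omega>. (A \<omega>, B \<omega>))"
    using ind by (auto simp: indep_pair_def)
  interpret B: prob_space "distr M T B" by (rule prob_space_distr) fact
  have f': "f \<in> borel_measurable (S \<Otimes>\<^sub>M distr M T B)" "f \<in> borel_measurable (distr M S A \<Otimes>\<^sub>M distr M T B)"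
    using f by (simp_all cong: measurable_cong_sets)
  have "(\<integral>\<^sup>+\<omega>. f (A \<omega>, B \<omega>) \<partial>M) = (\<integral>\<^sup>+z. f z \<partial>(distr M S A \<Otimes>\<^sub>M distr M T B))"
    unfolding eq using f by (intro nn_integral_distr[symmetric] measurable_Pair rv) simp
  also have "\<dots> = (\<integral>\<^sup>+x. (\<integral>\<^sup>+y. f (x, y) \<partial>distr M T B) \<partial>distr M S A)"
    using f'(2) by (rule B.nn_integral_fst[symmetric])
  also have "\<dots> = (\<integral>\<^sup>+\<omega>. (\<integral>\<^sup>+y. f (A \<omega>, y) \<partial>distr M T B) \<partial>M)"
    using rv(1) B.borel_measurable_nn_integral_fst[OF f'(1)] by (subst nn_integral_distr) simp_all
  finally show ?thesis .
qed

text \<open>With \<open>A\<close> frozen in \<open>E\<close>, the variable \<open>B\<close> meets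
  the section of \<open>G\<close> with probability at most \<open>q\<close>; integrating over
  \<open>A\<close> multiplies the probability of \<open>E\<close> by this factor. Used as a one-step
  Markov estimate, with \<open>A\<close> the present state and \<open>B\<close> the next
  input.\<close>

lemma prob_indep_pair_le:
  assumes ind: "indep_pair S A T B" and E: "E \<in> sets S" and G: "G \<in> sets (S \<Otimes>\<^sub>M T)"
    and q: "\<And>\<omega>. \<omega> \<in> space M \<Longrightarrow> A \<omega> \<in> E \<Longrightarrow> emeasure (distr M T B) {y. (A \<omega>, y) \<in> G} \<le> ennreal q"
    and "0 \<le> q"
  shows "prob {\<omega> \<in> space M. A \<omega> \<in> E \<and> (A \<omega>, B \<omega>) \<in> G} \<le> q * prob {\<omega> \<in> space M. A \<omega> \<in> E}"
proof -
  have rv[measurable]: "A \<in> M \<rightarrow>\<^sub>M S" "B \<in> M \<rightarrow>\<^sub>M T"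
    using ind by (auto simp: indep_pair_def)
  note [measurable] = E G
  have "emeasure M {\<omega> \<in> space M. A \<omega> \<in> E \<and> (A \<omega>, B \<omega>) \<in> G}
      = (\<integral>\<^sup>+\<omega>. indicator {\<omega> \<in> space M. A \<omega> \<in> E \<and> (A \<omega>, B \<omega>) \<in> G} \<omega> \<partial>M)"
    by (rule nn_integral_indicator[symmetric]) measurable
  also have "\<dots> = (\<integral>\<^sup>+\<omega>. indicator E (A \<omega>) * indicator G (A \<omega>, B \<omega>) \<partial>M)"
    by (intro nn_integral_cong) (simp add: indicator_def)
  also have "\<dots> = (\<integral>\<^sup>+\<omega>. \<integral>\<^sup>+y. indicator E (A \<omega>) * indicator G (A \<omega>, y) \<partial>distr M T B \<partial>M)"
    using nn_integral_indep_pair[OF ind, of "\<lambda>z. indicator E (fst z) * indicator G z"] by simp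
  also have "\<dots> \<le> (\<integral>\<^sup>+\<omega>. ennreal q * indicator {\<omega> \<in> space M. A \<omega> \<in> E} \<omega> \<partial>M)"
  proof (rule nn_integral_mono)
    fix \<omega> assume \<omega>: "\<omega> \<in> space M"
    have sec: "Pair (A \<omega>) -` G \<in> sets (distr M T B)" using sets_Pair1[OF G] by simp
    have "(\<integral>\<^sup>+y. indicator E (A \<omega>) * indicator G (A \<omega>, y) \<partial>distr M T B)
        = (\<integral>\<^sup>+y. indicator E (A \<omega>) * indicator (Pair (A \<omega>) -` G) y \<partial>distr M T B)"
      by (intro nn_integral_cong) (simp add: indicator_def)
    also have "\<dots> = indicator E (A \<omega>) * emeasure (distr M T B) (Pair (A \<omega>) -` G)"
      using sec by (rule nn_integral_cmult_indicator)
    also have "\<dots> \<le> ennreal q * indicator {\<omega> \<in> space M. A \<omega> \<in> E} \<omega>"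
      using q[of \<omega>] \<omega> by (cases "A \<omega> \<in> E") (simp_all add: vimage_def)
    finally show "(\<integral>\<^sup>+y. indicator E (A \<omega>) * indicator G (A \<omega>, y) \<partial>distr M T B)
        \<le> ennreal q * indicator {\<omega> \<in> space M. A \<omega> \<in> E} \<omega>" .
  qed
  also have "\<dots> = ennreal q * emeasure M {\<omega> \<in> space M. A \<omega> \<in> E}"
    by (rule nn_integral_cmult_indicator) measurable
  finally show ?thesis
    using \<open>0 \<le> q\<close> by (simp add: emeasure_eq_measure flip: ennreal_mult)
qed

lemma indep_pair_past:
  fixes X :: "nat \<Rightarrow> 'a \<Rightarrow> 'b"
  assumes "indep_vars (\<lambda>_. N) X {..<Suc n}"
  shows "indep_pair (PiM {..<n} (\<lambda>_. N)) (\<lambda>\<omega>. \<lambda>i\<in>{..<n}. X i \<omega>) N (X n)"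
proof -
  have "indep_var (PiM {..<n} (\<lambda>_. N)) (\<lambda>\<omega>. \<lambda>i\<in>{..<n}. X i \<omega>) (PiM {n} (\<lambda>_. N)) (\<lambda>\<omega>. \<lambda>i\<in>{n}. X i \<omega>)"
    using assms by (rule indep_var_restrict) auto
  from indep_pair_compose[OF indep_var_imp_indep_pair[OF this] measurable_ident measurable_component_singleton[of n "{n}"]]
  show ?thesis by simp
qed

lemma indep_pair_iterates:
  fixes X :: "nat \<Rightarrow> 'a \<Rightarrow> 'b :: topological_space" and s :: "'s :: topological_space"
  assumes u: "case_prod u \<in> borel \<Otimes>\<^sub>M borel \<rightarrow>\<^sub>M borel"
    and ind: "indep_pair (PiM {..<n} (\<lambda>_. borel)) (\<lambda>\<omega>. \<lambda>i\<in>{..<n}. X i \<omega>) borel (X n)"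
  shows "indep_pair borel (\<lambda>\<omega>. iterates u s (\<lambda>i. X i \<omega>) n) borel (X n)"
proof -
  have "iterates u s (\<lambda>i\<in>{..<n}. X i \<omega>) n = iterates u s (\<lambda>i. X i \<omega>) n" for \<omega>
    by (rule iterates_cong) simp
  then show ?thesis
    using indep_pair_compose[OF ind measurable_iterates[OF u order_refl, of s n] measurable_ident]
    by simp
qed

text \<open>Meant for \<open>A\<close>, \<open>B\<close> the past and the next increment of one
  coordinate and \<open>C\<close>, \<open>D\<close> those of the other: independence in time within
  each coordinate and independence between coordinates yield independence of the planar past and the
  next planar increment. The joint law is a product of four laws, whose two middle factors may be
  exchanged.\<close>

lemma indep_pair_interchange:
  assumes AB: "indep_pair S1 A T1 B" and CD: "indep_pair S2 C T2 D"
    and ABCD: "indep_pair (S1 \<Otimes>\<^sub>M T1) (\<lambda>\<omega>. (A \<omega>, B \<omega>)) (S2 \<Otimes>\<^sub>M T2) (\<lambda>\<omega>. (C \<omega>, D \<omega>))"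
  shows "indep_pair (S1 \<Otimes>\<^sub>M S2) (\<lambda>\<omega>. (A \<omega>, C \<omega>)) (T1 \<Otimes>\<^sub>M T2) (\<lambda>\<omega>. (B \<omega>, D \<omega>))"
    and "indep_pair T1 B T2 D"
proof -
  have [measurable]: "A \<in> M \<rightarrow>\<^sub>M S1" "B \<in> M \<rightarrow>\<^sub>M T1" "C \<in> M \<rightarrow>\<^sub>M S2" "D \<in> M \<rightarrow>\<^sub>M T2"
    using AB CD by (auto simp: indep_pair_def)
  show BD: "indep_pair T1 B T2 D"
    using indep_pair_compose[OF ABCD measurable_snd measurable_snd] by simp
  have AC: "indep_pair S1 A S2 C"
    using indep_pair_compose[OF ABCD measurable_fst measurable_fst] by simp
  define a b c d where "a = distr M S1 A" and "b = distr M T1 B" and "c = distr M S2 C" and "d = distr M T2 D"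
  interpret a: prob_space a unfolding a_def by (rule prob_space_distr) measurable
  interpret b: prob_space b unfolding b_def by (rule prob_space_distr) measurable
  interpret c: prob_space c unfolding c_def by (rule prob_space_distr) measurable
  interpret d: prob_space d unfolding d_def by (rule prob_space_distr) measurable
  interpret cd: prob_space "c \<Otimes>\<^sub>M d" by (intro prob_space_pair c.prob_space_axioms d.prob_space_axioms)
  interpret bd: prob_space "b \<Otimes>\<^sub>M d" by (intro prob_space_pair b.prob_space_axioms d.prob_space_axioms)
  interpret bc: pair_sigma_finite b c ..
  have sets[measurable_cong]: "sets a = sets S1" "sets b = sets T1" "sets c = sets S2" "sets d = sets T2"
    by (simp_all add: a_def b_def c_def d_def)
  have law: "distr M ((S1 \<Otimes>\<^sub>M T1) \<Otimes>\<^sub>M (S2 \<Otimes>\<^sub>M T2)) (\<lambda>\<omega>. ((A \<omega>, B \<omega>), (C \<omega>, D \<omega>))) = (a \<Otimes>\<^sub>M b) \<Otimes>\<^sub>M (c \<Otimes>\<^sub>M d)"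
    using AB CD ABCD by (simp add: indep_pair_def a_def b_def c_def d_def)
  have "distr M ((S1 \<Otimes>\<^sub>M S2) \<Otimes>\<^sub>M (T1 \<Otimes>\<^sub>M T2)) (\<lambda>\<omega>. ((A \<omega>, C \<omega>), (B \<omega>, D \<omega>))) = (a \<Otimes>\<^sub>M c) \<Otimes>\<^sub>M (b \<Otimes>\<^sub>M d)"
  proof (rule measure_eqI)
    show "sets (distr M ((S1 \<Otimes>\<^sub>M S2) \<Otimes>\<^sub>M (T1 \<Otimes>\<^sub>M T2)) (\<lambda>\<omega>. ((A \<omega>, C \<omega>), (B \<omega>, D \<omega>)))) = sets ((a \<Otimes>\<^sub>M c) \<Otimes>\<^sub>M (b \<Otimes>\<^sub>M d))"
      by (simp add: sets cong: sets_pair_measure_cong)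
    fix E assume "E \<in> sets (distr M ((S1 \<Otimes>\<^sub>M S2) \<Otimes>\<^sub>M (T1 \<Otimes>\<^sub>M T2)) (\<lambda>\<omega>. ((A \<omega>, C \<omega>), (B \<omega>, D \<omega>))))"
    then have E[measurable]: "E \<in> sets ((S1 \<Otimes>\<^sub>M S2) \<Otimes>\<^sub>M (T1 \<Otimes>\<^sub>M T2))" by simp
    have "emeasure (distr M ((S1 \<Otimes>\<^sub>M S2) \<Otimes>\<^sub>M (T1 \<Otimes>\<^sub>M T2)) (\<lambda>\<omega>. ((A \<omega>, C \<omega>), (B \<omega>, D \<omega>)))) E
      = (\<integral>\<^sup>+z. indicator E z \<partial>distr M ((S1 \<Otimes>\<^sub>M S2) \<Otimes>\<^sub>M (T1 \<Otimes>\<^sub>M T2)) (\<lambda>\<omega>. ((A \<omega>, C \<omega>), (B \<omega>, D \<omega>))))"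
      by (rule nn_integral_indicator[symmetric]) measurable
    also have "\<dots> = (\<integral>\<^sup>+\<omega>. indicator E ((A \<omega>, C \<omega>), (B \<omega>, D \<omega>)) \<partial>M)"
      by (rule nn_integral_distr) measurable
    also have "\<dots> = (\<integral>\<^sup>+p. indicator E ((fst (fst p), fst (snd p)), (snd (fst p), snd (snd p))) \<partial>((a \<Otimes>\<^sub>M b) \<Otimes>\<^sub>M (c \<Otimes>\<^sub>M d)))"
      unfolding law[symmetric] by (subst nn_integral_distr) simp_all
    also have "\<dots> = (\<integral>\<^sup>+x. \<integral>\<^sup>+y. \<integral>\<^sup>+z. \<integral>\<^sup>+w. indicator E ((x, z), (y, w)) \<partial>d \<partial>c \<partial>b \<partial>a)"
    proof -
      have "(\<integral>\<^sup>+p. indicator E ((x, fst p), (y, snd p)) \<partial>(c \<Otimes>\<^sub>M d)) = (\<integral>\<^sup>+z. \<integral>\<^sup>+w. indicator E ((x, z), (y, w)) \<partial>d \<partial>c)"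
        if "x \<in> space a" "y \<in> space b" for x y
      proof -
        have "x \<in> space S1" "y \<in> space T1" using that by (simp_all add: a_def b_def)
        then have "(\<lambda>p. indicator E ((x, fst p), (y, snd p)) :: ennreal) \<in> borel_measurable (c \<Otimes>\<^sub>M d)"
          by measurable
        from d.nn_integral_fst[OF this] show ?thesis by simp
      qed
      then show ?thesis
        by (simp add: cd.nn_integral_fst[symmetric] b.nn_integral_fst[symmetric] cong: nn_integral_cong)
    qed
    \<comment> \<open>The only change of order: the integrals over the laws of \<open>B\<close> and
      \<open>C\<close> are exchanged.\<close>
    also have "\<dots> = (\<integral>\<^sup>+x. \<integral>\<^sup>+z. \<integral>\<^sup>+y. \<integral>\<^sup>+w. indicator E ((x, z), (y, w)) \<partial>d \<partial>b \<partial>c \<partial>a)"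
    proof (intro nn_integral_cong bc.Fubini'[symmetric])
      fix x assume "x \<in> space a"
      then have "x \<in> space S1" by (simp add: a_def)
      then show "(\<lambda>(y, z). \<integral>\<^sup>+w. indicator E ((x, z), (y, w)) \<partial>d) \<in> borel_measurable (b \<Otimes>\<^sub>M c)"
        by measurable
    qed
    also have "\<dots> = (\<integral>\<^sup>+z. indicator E z \<partial>((a \<Otimes>\<^sub>M c) \<Otimes>\<^sub>M (b \<Otimes>\<^sub>M d)))"
    proof -
      have "(\<integral>\<^sup>+p. indicator E ((x, z), p) \<partial>(b \<Otimes>\<^sub>M d)) = (\<integral>\<^sup>+y. \<integral>\<^sup>+w. indicator E ((x, z), (y, w)) \<partial>d \<partial>b)"
        if "x \<in> space a" "z \<in> space c" for x z
      proof -
        have "x \<in> space S1" "z \<in> space S2" using that by (simp_all add: a_def c_def)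
        then have "(\<lambda>p. indicator E ((x, z), p) :: ennreal) \<in> borel_measurable (b \<Otimes>\<^sub>M d)"
          by measurable
        from d.nn_integral_fst[OF this] show ?thesis by simp
      qed
      then show ?thesis
        by (simp add: bd.nn_integral_fst[symmetric] c.nn_integral_fst[symmetric] del: nn_integral_indicator cong: nn_integral_cong)
    qed
    also have "\<dots> = emeasure ((a \<Otimes>\<^sub>M c) \<Otimes>\<^sub>M (b \<Otimes>\<^sub>M d)) E"
      by (rule nn_integral_indicator) measurable
    finally show "emeasure (distr M ((S1 \<Otimes>\<^sub>M S2) \<Otimes>\<^sub>M (T1 \<Otimes>\<^sub>M T2)) (\<lambda>\<omega>. ((A \<omega>, C \<omega>), (B \<omega>, D \<omega>)))) E
      = emeasure ((a \<Otimes>\<^sub>M c) \<Otimes>\<^sub>M (b \<Otimes>\<^sub>M d)) E" .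
  qed
  moreover have "distr M (S1 \<Otimes>\<^sub>M S2) (\<lambda>\<omega>. (A \<omega>, C \<omega>)) = a \<Otimes>\<^sub>M c" "distr M (T1 \<Otimes>\<^sub>M T2) (\<lambda>\<omega>. (B \<omega>, D \<omega>)) = b \<Otimes>\<^sub>M d"
    using AC BD by (auto simp: indep_pair_def a_def b_def c_def d_def)
  ultimately show "indep_pair (S1 \<Otimes>\<^sub>M S2) (\<lambda>\<omega>. (A \<omega>, C \<omega>)) (T1 \<Otimes>\<^sub>M T2) (\<lambda>\<omega>. (B \<omega>, D \<omega>))"
    by (simp add: indep_pair_def)
qed

end

section \<open>Growing a triangle along the path\<close>

type_synonym triple = "complex \<times> complex \<times> complex"

definition success :: "triple \<Rightarrow> bool" where
  "success s = (case s of (P, Q, Z) \<Rightarrow> wide_triangle P Q Z)"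

definition base_length :: "triple \<Rightarrow> real" where
  "base_length s = (case s of (P, Q, Z) \<Rightarrow> norm (Q - P))"

text \<open>
  A triple \<open>(P, Q, Z)\<close> holds two visited points and the current position; it is frozen once the
  triangle is wide.
\<close>
definition update_triple :: "triple \<Rightarrow> real \<times> real \<Rightarrow> triple" where
  "update_triple s x = (case s of (P, Q, Z) \<Rightarrow>
     let Z' = Z + complex_of_pair x in
     if wide_triangle P Q Z then (P, Q, Z)
     else if norm (Q - P) < 43 / 10 then (Z, Z', Z')
     else if wide_triangle P Q Z' then (P, Q, Z')
     else if norm (Q - P) \<le> norm (Z' - P) then (P, Z', Z')
     else if norm (Q - P) \<le> norm (Z' - Q) then (Q, Z', Z')
     else (P, Q, Z'))"

section \<open>Measurability of the update\<close>

lemma continuous_on_complex_of_pair: "continuous_on A complex_of_pair"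
  unfolding complex_of_pair_def Complex_eq by (intro continuous_intros)

lemma closed_wide_triangle:
  assumes "continuous_on UNIV f" "continuous_on UNIV g" "continuous_on UNIV h"
  shows "closed {y. wide_triangle (f y) (g y) (h y)}"
  unfolding wide_triangle_def
  by (intro closed_Collect_conj closed_Collect_le continuous_intros assms)

lemma closed_success: "closed {s. success s}"
  unfolding success_def split_beta by (intro closed_wide_triangle continuous_intros)

lemma measurable_update_triple: "case_prod update_triple \<in> borel \<Otimes>\<^sub>M borel \<rightarrow>\<^sub>M borel"
proof -
  define P Q Z Z' :: "triple \<times> real \<times> real \<Rightarrow> complex"
    where "P = (\<lambda>y. fst (fst y))" and "Q = (\<lambda>y. fst (snd (fst y)))"
      and "Z = (\<lambda>y. snd (snd (fst y)))" and "Z' = (\<lambda>y. snd (snd (fst y)) + complex_of_pair (snd y))"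
  have c: "continuous_on UNIV P" "continuous_on UNIV Q" "continuous_on UNIV Z" "continuous_on UNIV Z'"
    unfolding P_def Q_def Z_def Z'_def
    by (intro continuous_intros continuous_on_compose2[OF continuous_on_complex_of_pair[of UNIV] continuous_on_snd] subset_UNIV)+
  have pred: "{y \<in> space borel. wide_triangle (P y) (Q y) (Z y)} \<in> sets borel"
    "{y \<in> space borel. wide_triangle (P y) (Q y) (Z' y)} \<in> sets borel"
    "{y \<in> space borel. norm (Q y - P y) < 43 / 10} \<in> sets borel"
    "{y \<in> space borel. norm (Q y - P y) \<le> norm (Z' y - P y)} \<in> sets borel"
    "{y \<in> space borel. norm (Q y - P y) \<le> norm (Z' y - Q y)} \<in> sets borel"
    using borel_closed[OF closed_wide_triangle[OF c(1) c(2) c(3)]]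
      borel_closed[OF closed_wide_triangle[OF c(1) c(2) c(4)]]
      borel_open[OF open_Collect_less[OF continuous_on_norm[OF continuous_on_diff[OF c(2) c(1)]] continuous_on_const]]
      borel_closed[OF closed_Collect_le[OF continuous_on_norm[OF continuous_on_diff[OF c(2) c(1)]] continuous_on_norm[OF continuous_on_diff[OF c(4) c(1)]]]]
      borel_closed[OF closed_Collect_le[OF continuous_on_norm[OF continuous_on_diff[OF c(2) c(1)]] continuous_on_norm[OF continuous_on_diff[OF c(4) c(2)]]]]
    unfolding space_borel by (simp_all only: UNIV_I simp_thms)
  have triples: "(\<lambda>y. (f y, g y, h y)) \<in> borel \<rightarrow>\<^sub>M borel"
    if "continuous_on UNIV f" "continuous_on UNIV g" "continuous_on UNIV h"
    for f g h :: "triple \<times> real \<times> real \<Rightarrow> complex"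
    using that by (intro borel_measurable_continuous_onI continuous_intros)
  have "case_prod update_triple = (\<lambda>y.
     if wide_triangle (P y) (Q y) (Z y) then (P y, Q y, Z y)
     else if norm (Q y - P y) < 43 / 10 then (Z y, Z' y, Z' y)
     else if wide_triangle (P y) (Q y) (Z' y) then (P y, Q y, Z' y)
     else if norm (Q y - P y) \<le> norm (Z' y - P y) then (P y, Z' y, Z' y)
     else if norm (Q y - P y) \<le> norm (Z' y - Q y) then (Q y, Z' y, Z' y)
     else (P y, Q y, Z' y))"
  proof
    fix y :: "triple \<times> real \<times> real"
    obtain p q z x where y: "y = ((p, q, z), x)" by (metis prod.exhaust)
    show "case_prod update_triple y = (
     if wide_triangle (P y) (Q y) (Z y) then (P y, Q y, Z y)
     else if norm (Q y - P y) < 43 / 10 then (Z y, Z' y, Z' y)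
     else if wide_triangle (P y) (Q y) (Z' y) then (P y, Q y, Z' y)
     else if norm (Q y - P y) \<le> norm (Z' y - P y) then (P y, Z' y, Z' y)
     else if norm (Q y - P y) \<le> norm (Z' y - Q y) then (Q y, Z' y, Z' y)
     else (P y, Q y, Z' y))"
      unfolding y by (simp only: update_triple_def prod.case fst_conv snd_conv Let_def P_def Q_def Z_def Z'_def)
  qed
  also have "\<dots> \<in> borel \<rightarrow>\<^sub>M borel"
    by (intro measurable_If pred triples c)
  finally show ?thesis by (simp add: borel_prod)
qed

section \<open>The projection of the current position stays in the base\<close>

definition foot_in_base :: "triple \<Rightarrow> bool" where
  "foot_in_base s = (case s of (P, Q, Z) \<Rightarrow>
     0 \<le> Re (cnj (Q - P) * (Z - P)) \<and> Re (cnj (Q - P) * (Z - P)) \<le> (norm (Q - P))\<^sup>2)"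

text \<open>Squaring the hypothesis gives
  \<open>(norm b)\<^sup>2 \<le> 2 * Re (cnj a * b)\<close>.\<close>

lemma foot_nonneg:
  assumes "norm (b - a) \<le> norm a"
  shows "0 \<le> Re (cnj a * b)"
proof -
  have "(norm (b - a))\<^sup>2 \<le> (norm a)\<^sup>2" using assms by (intro power_mono) auto
  then have "(Re b)\<^sup>2 + (Im b)\<^sup>2 \<le> 2 * Re (cnj a * b)"
    by (simp add: cmod_power2 power2_diff algebra_simps)
  then show ?thesis
    using zero_le_power2[of "Re b"] zero_le_power2[of "Im b"] by linarith
qed

text \<open>A new base ends at the current position, whose projection is then an endpoint. An old
  base survives a failing step only when both distances of the position to its ends are smaller than
  its length, and then \<open>foot_nonneg\<close> applies from either end.\<close>

lemma foot_in_base_update: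
  assumes "success s \<or> foot_in_base s"
  shows "success (update_triple s x) \<or> foot_in_base (update_triple s x)"
proof -
  have self: "foot_in_base (P, Q, Q)" for P Q
  proof -
    have "Re (cnj (Q - P) * (Q - P)) = (norm (Q - P))\<^sup>2"
      using complex_norm_square[of "Q - P"] by (metis Re_complex_of_real mult.commute)
    then show ?thesis
      unfolding foot_in_base_def prod.case by (simp only: zero_le_power2 order_refl simp_thms)
  qed
  have sym: "Re (cnj (P - Q) * (Z - Q)) = (norm (Q - P))\<^sup>2 - Re (cnj (Q - P) * (Z - P))" for P Z Q
    unfolding cmod_power2 by (simp add: power2_eq_square algebra_simps)
  have near: "foot_in_base (P, Q, Z)" if "norm (Z - P) \<le> norm (Q - P)" "norm (Z - Q) \<le> norm (Q - P)" for P Q Z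
  proof -
    have e: "Z - P - (Q - P) = Z - Q" "Z - Q - (P - Q) = Z - P" by simp_all
    have "0 \<le> Re (cnj (Q - P) * (Z - P))"
      by (rule foot_nonneg, unfold e) (rule that(2))
    moreover have "0 \<le> Re (cnj (P - Q) * (Z - Q))"
      by (rule foot_nonneg, unfold e norm_minus_commute[of P Q]) (rule that(1))
    ultimately show ?thesis
      unfolding foot_in_base_def prod.case by (simp only: sym[where P=P and Q=Q and Z=Z] diff_ge_0_iff_ge simp_thms)
  qed
  obtain P Q Z where s: "s = (P, Q, Z)" by (cases s)
  define Z' where "Z' = Z + complex_of_pair x"
  consider "wide_triangle P Q Z" | "\<not> wide_triangle P Q Z" "norm (Q - P) < 43 / 10"
    | "\<not> wide_triangle P Q Z" "\<not> norm (Q - P) < 43 / 10" "wide_triangle P Q Z'"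
    | "\<not> wide_triangle P Q Z" "\<not> norm (Q - P) < 43 / 10" "\<not> wide_triangle P Q Z'"
    by blast
  then show ?thesis
  proof cases
    case 1
    then show ?thesis unfolding s update_triple_def success_def prod.case Let_def by (simp only: if_True prod.case simp_thms)
  next
    case 2
    then show ?thesis using self unfolding s update_triple_def prod.case Let_def by (simp only: if_True if_False simp_thms)
  next
    case 3
    then show ?thesis
      unfolding s update_triple_def success_def prod.case Let_def Z'_def[symmetric] by (simp only: if_True if_False prod.case simp_thms)
  next
    case 4
    then have m: "update_triple s x = (if norm (Q - P) \<le> norm (Z' - P) then (P, Z', Z')
        else if norm (Q - P) \<le> norm (Z' - Q) then (Q, Z', Z') else (P, Q, Z'))"
      unfolding s update_triple_def prod.case Let_def Z'_def[symmetric] by (simp only: if_False)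
    have "foot_in_base (update_triple s x)"
    proof (cases "norm (Q - P) \<le> norm (Z' - P) \<or> norm (Q - P) \<le> norm (Z' - Q)")
      case True
      then have "update_triple s x = (P, Z', Z') \<or> update_triple s x = (Q, Z', Z')" unfolding m by metis
      then show ?thesis using self by metis
    next
      case False
      then have "foot_in_base (P, Q, Z')" by (intro near) linarith+
      moreover have "update_triple s x = (P, Q, Z')" using False unfolding m by metis
      ultimately show ?thesis by metis
    qed
    then show ?thesis ..
  qed
qed

section \<open>Expected number of failing steps\<close>

lemma closed_foot_in_base: "closed {s. foot_in_base s}"
  unfolding foot_in_base_def split_beta
  by (intro closed_Collect_conj closed_Collect_le continuous_intros)

lemma continuous_on_base_length: "continuous_on A base_length"
  unfolding base_length_def split_beta by (intro continuous_intros)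

lemma wide_triangle_imp_base: "wide_triangle P Q Z \<Longrightarrow> 43 / 10 \<le> norm (Q - P)"
  unfolding wide_triangle_def by blast

lemma success_imp_base: "success s \<Longrightarrow> 43 / 10 \<le> base_length s"
  using wide_triangle_imp_base unfolding success_def base_length_def split_beta by blast

text \<open>A base of length at least \<open>4.3\<close> is only ever kept or replaced by one at
  least as long, while a shorter base is replaced by the last increment.\<close>

lemma base_update_less_imp:
  assumes "base_length (update_triple s x) < 43 / 10"
  shows "base_length s < 43 / 10 \<and> norm x < 43 / 10"
proof -
  obtain P Q Z where s: "s = (P, Q, Z)" by (cases s)
  define R where "R = norm (Q - P)"
  show ?thesis
  proof (cases "R < 43 / 10")
    case True
    then have "\<not> wide_triangle P Q Z"
      using wide_triangle_imp_base[of P Q Z] unfolding R_def by linarith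
    then have "update_triple s x = (Z, Z + complex_of_pair x, Z + complex_of_pair x)"
      using True unfolding s update_triple_def R_def Let_def by simp
    then show ?thesis
      using assms True unfolding s base_length_def R_def by simp
  next
    case False
    then have "43 / 10 \<le> base_length (update_triple s x)"
      unfolding s update_triple_def prod.case Let_def R_def[symmetric]
      by (simp only: if_False base_length_def prod.case split: if_split) (unfold R_def[symmetric], linarith)
    then show ?thesis using assms by linarith
  qed
qed

lemma not_success_update_imp:
  assumes "\<not> success (update_triple s x)"
  shows "\<not> success s" and "43 / 10 \<le> base_length s \<Longrightarrow> \<not> wide_triangle (fst s) (fst (snd s)) (snd (snd s) + complex_of_pair x)"
proof -
  obtain P Q Z where s: "s = (P, Q, Z)" by (cases s)
  have "\<not> wide_triangle P Q Z"
    using assms unfolding s success_def update_triple_def by (cases "wide_triangle P Q Z") simp_all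
  then show "\<not> success s" by (simp add: s success_def)
  assume "43 / 10 \<le> base_length s"
  then have "\<not> norm (Q - P) < 43 / 10" by (simp add: s base_length_def)
  then have "\<not> wide_triangle P Q (Z + complex_of_pair x)"
    using assms \<open>\<not> wide_triangle P Q Z\<close> unfolding s success_def update_triple_def Let_def prod.case
    by (cases "wide_triangle P Q (Z + complex_of_pair x)") (simp_all only: if_True if_False prod.case simp_thms)
  then show "\<not> wide_triangle (fst s) (fst (snd s)) (snd (snd s) + complex_of_pair x)" by (simp add: s)
qed

text \<open>A failing state has either a short base (\<open>E1\<close>, probability
  \<open>a k\<close>) or a long base with the foot inside it (\<open>E2\<close>, probability
  \<open>b k\<close>). The first probability decays by the factor \<open>0.74\<close>, and a state
  in \<open>E2\<close> fails again with probability at most \<open>7 / 8\<close>. The bound is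
  \<open>154 / 13 = 1 / 0.26 + 8\<close>.\<close>

lemma (in prob_space) expected_steps_bound:
  fixes X :: "nat \<Rightarrow> 'a \<Rightarrow> real \<times> real"
  assumes ind: "\<And>n. indep_pair (PiM {..<n} (\<lambda>_. borel)) (\<lambda>\<omega>. \<lambda>i\<in>{..<n}. X i \<omega>) borel (X n)"
    and law: "\<And>n. distr M borel (X n) = planar_normal_law 7"
  defines "st \<equiv> \<lambda>n \<omega>. iterates update_triple (0, 0, 0) (\<lambda>i. X i \<omega>) n"
  shows "(\<Sum>k<n. prob {\<omega> \<in> space M. \<not> success (st k \<omega>)}) \<le> 154 / 13"
proof -
  define E1 where "E1 = {s. base_length s < 43 / 10}"
  define E2 where "E2 = {s. 43 / 10 \<le> base_length s} \<inter> {s. foot_in_base s} \<inter> (- {s. success s})"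
  define a where "a k = prob {\<omega> \<in> space M. st k \<omega> \<in> E1}" for k
  define b where "b k = prob {\<omega> \<in> space M. st k \<omega> \<in> E2}" for k
  have E1: "E1 \<in> sets borel"
    unfolding E1_def by (intro borel_open open_Collect_less continuous_on_base_length continuous_on_const)
  have E2: "E2 \<in> sets borel"
    unfolding E2_def
    by (intro sets.Int borel_comp borel_closed closed_Collect_le closed_foot_in_base closed_success
         continuous_on_base_length continuous_on_const)
  have failure_sets: "{s. \<not> success s} \<in> sets borel"
    using borel_comp[OF borel_closed[OF closed_success]] by (simp add: Collect_neg_eq)
  have indst: "indep_pair borel (st k) borel (X k)" for k
    unfolding st_def by (intro indep_pair_iterates measurable_update_triple ind)
  then have st[measurable]: "st k \<in> M \<rightarrow>\<^sub>M borel" for k by (simp add: indep_pair_def)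
  have st_Suc: "st (Suc k) \<omega> = update_triple (st k \<omega>) (X k \<omega>)" for k \<omega> by (simp add: st_def)
  have foot: "success (st k \<omega>) \<or> foot_in_base (st k \<omega>)" for k \<omega>
  proof (induction k)
    case 0
    show ?case by (simp add: st_def foot_in_base_def)
  next
    case (Suc k)
    then show ?case unfolding st_Suc by (rule foot_in_base_update)
  qed
  note [measurable] = E1 E2 failure_sets
  have split: "prob {\<omega> \<in> space M. \<not> success (st k \<omega>)} = a k + b k" for k
  proof -
    have "{\<omega> \<in> space M. \<not> success (st k \<omega>)} = {\<omega> \<in> space M. st k \<omega> \<in> E1} \<union> {\<omega> \<in> space M. st k \<omega> \<in> E2}"
    proof (intro set_eqI)
      fix \<omega>
      show "\<omega> \<in> {\<omega> \<in> space M. \<not> success (st k \<omega>)} \<longleftrightarrow>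
          \<omega> \<in> {\<omega> \<in> space M. st k \<omega> \<in> E1} \<union> {\<omega> \<in> space M. st k \<omega> \<in> E2}"
        using foot[of k \<omega>] success_imp_base[of "st k \<omega>"] unfolding E1_def E2_def
        by (cases "base_length (st k \<omega>) < 43 / 10") auto
    qed
    also have "prob \<dots> = a k + b k"
      unfolding a_def b_def
    proof (rule finite_measure_Union)
      show "{\<omega> \<in> space M. st k \<omega> \<in> E1} \<inter> {\<omega> \<in> space M. st k \<omega> \<in> E2} = {}"
        by (auto simp: E1_def E2_def)
    qed measurable
    finally show ?thesis .
  qed
  have a_Suc: "a (Suc k) \<le> 37 / 50 * a k" for k
  proof -
    define G where "G = {z :: triple \<times> real \<times> real. norm (snd z) < 43 / 10}"
    have "open G" unfolding G_def by (intro open_Collect_less continuous_intros)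
    then have G: "G \<in> sets (borel \<Otimes>\<^sub>M borel)" unfolding borel_prod by (rule borel_open)
    note [measurable] = G
    have X[measurable]: "X k \<in> M \<rightarrow>\<^sub>M borel" using indst[of k] by (simp add: indep_pair_def)
    have "a (Suc k) \<le> prob {\<omega> \<in> space M. st k \<omega> \<in> E1 \<and> (st k \<omega>, X k \<omega>) \<in> G}"
      unfolding a_def
    proof (rule finite_measure_mono)
      show "{\<omega> \<in> space M. st (Suc k) \<omega> \<in> E1} \<subseteq> {\<omega> \<in> space M. st k \<omega> \<in> E1 \<and> (st k \<omega>, X k \<omega>) \<in> G}"
        using base_update_less_imp unfolding E1_def G_def st_Suc mem_Collect_eq snd_conv by blast
    qed measurable
    also have "\<dots> \<le> 37 / 50 * prob {\<omega> \<in> space M. st k \<omega> \<in> E1}"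
      by (rule prob_indep_pair_le[OF indst E1 G]) (simp_all add: law G_def emeasure_short_step del: less_divide_eq_numeral1)
    finally show ?thesis by (simp add: a_def)
  qed
  \<comment> \<open>No success is credited to steps from \<open>E1\<close>: such a state may pass to
    \<open>E2\<close>, so only the total failure probability is estimated.\<close>
  have ab_Suc: "a (Suc k) + b (Suc k) \<le> a k + 7 / 8 * b k" for k
  proof -
    define G where "G = - {z :: triple \<times> real \<times> real.
      wide_triangle (fst (fst z)) (fst (snd (fst z))) (snd (snd (fst z)) + complex_of_pair (snd z))}"
    have c: "continuous_on A (\<lambda>y. complex_of_pair (snd y))" for A :: "(triple \<times> real \<times> real) set"
      by (intro continuous_on_compose2[OF continuous_on_complex_of_pair[of UNIV]] continuous_intros) auto
    have "G \<in> sets borel"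
      unfolding G_def wide_triangle_def
      by (intro borel_comp borel_closed closed_Collect_conj closed_Collect_le continuous_intros c)
    then have G: "G \<in> sets (borel \<Otimes>\<^sub>M borel)" unfolding borel_prod .
    note [measurable] = G
    have X[measurable]: "X k \<in> M \<rightarrow>\<^sub>M borel" using indst[of k] by (simp add: indep_pair_def)
    have "a (Suc k) + b (Suc k) = prob {\<omega> \<in> space M. \<not> success (st (Suc k) \<omega>)}"
      by (simp add: split)
    also have "\<dots> \<le> prob ({\<omega> \<in> space M. st k \<omega> \<in> E1} \<union> {\<omega> \<in> space M. st k \<omega> \<in> E2 \<and> (st k \<omega>, X k \<omega>) \<in> G})"
    proof (rule finite_measure_mono)
      show "{\<omega> \<in> space M. \<not> success (st (Suc k) \<omega>)}
        \<subseteq> {\<omega> \<in> space M. st k \<omega> \<in> E1} \<union> {\<omega> \<in> space M. st k \<omega> \<in> E2 \<and> (st k \<omega>, X k \<omega>) \<in> G}"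
      proof
        fix \<omega> assume \<omega>: "\<omega> \<in> {\<omega> \<in> space M. \<not> success (st (Suc k) \<omega>)}"
        show "\<omega> \<in> {\<omega> \<in> space M. st k \<omega> \<in> E1} \<union> {\<omega> \<in> space M. st k \<omega> \<in> E2 \<and> (st k \<omega>, X k \<omega>) \<in> G}"
        proof (cases "base_length (st k \<omega>) < 43 / 10")
          case True
          then show ?thesis using \<omega> by (simp add: E1_def)
        next
          case False
          moreover have "\<not> success (update_triple (st k \<omega>) (X k \<omega>))" using \<omega> by (simp add: st_Suc)
          ultimately show ?thesis
            using \<omega> not_success_update_imp[of "st k \<omega>" "X k \<omega>"] foot[of k \<omega>] by (simp add: E2_def G_def)
        qed
      qed
    qed measurable
    also have "\<dots> \<le> a k + prob {\<omega> \<in> space M. st k \<omega> \<in> E2 \<and> (st k \<omega>, X k \<omega>) \<in> G}"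
      unfolding a_def by (rule measure_Un_le) measurable
    also have "prob {\<omega> \<in> space M. st k \<omega> \<in> E2 \<and> (st k \<omega>, X k \<omega>) \<in> G} \<le> 7 / 8 * prob {\<omega> \<in> space M. st k \<omega> \<in> E2}"
    proof (rule prob_indep_pair_le[OF indst E2 G])
      fix \<omega> assume *: "st k \<omega> \<in> E2"
      obtain P Q Z where s: "st k \<omega> = (P, Q, Z)" by (cases "st k \<omega>")
      have "{y. (st k \<omega>, y) \<in> G} = {x. \<not> wide_triangle P Q (Z + complex_of_pair x)}"
        by (auto simp: G_def s)
      then show "emeasure (distr M borel (X k)) {y. (st k \<omega>, y) \<in> G} \<le> ennreal (7 / 8)"
        using * emeasure_no_wide_triangle[of Q P Z] unfolding s law E2_def base_length_def foot_in_base_def by simp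
    qed simp
    finally show ?thesis by (simp add: b_def)
  qed
  \<comment> \<open>The weights make \<open>154 / 13 * a + 8 * b = 50 / 13 * a + 8 * (a + b)\<close>
    drop by at least \<open>a + b\<close> in each step. The start \<open>(0, 0, 0)\<close> has a
    base of length zero, so its potential is at most \<open>154 / 13\<close>.\<close>
  have "(\<Sum>k<n. a k + b k) + (154 / 13 * a n + 8 * b n) \<le> 154 / 13"
  proof (induction n)
    case 0
    have "a 0 \<le> 1" by (simp add: a_def)
    moreover have "b 0 = 0" by (simp add: b_def st_def E2_def base_length_def)
    ultimately show ?case by simp
  next
    case (Suc n)
    then show ?case using a_Suc[of n] ab_Suc[of n] unfolding sum.lessThan_Suc by argo
  qed
  moreover have "0 \<le> a n" "0 \<le> b n" by (simp_all add: a_def b_def)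
  ultimately show ?thesis unfolding split by linarith
qed

section \<open>The range of a linear walk\<close>

lemma (in standard_brownian_motion) distr_increment:
  assumes "0 \<le> s" "s < t"
  shows "distr M borel (\<lambda>\<omega>. B t \<omega> - B s \<omega>) = normal_law (t - s)"
proof -
  have "distr M borel (\<lambda>\<omega>. B t \<omega> - B s \<omega>) = distr M lborel (\<lambda>\<omega>. B t \<omega> - B s \<omega>)"
    by (rule distr_cong) simp_all
  also have "\<dots> = normal_law (t - s)"
    using normal_increments[OF assms] by (rule distributed_distr_eq_density)
  finally show ?thesis .
qed

lemma (in standard_brownian_motion) indep_grid_increments:
  assumes "0 < h"
  shows "indep_pair (PiM {..<n} (\<lambda>_. borel)) (\<lambda>\<omega>. \<lambda>i\<in>{..<n}. B (h * real (Suc i)) \<omega> - B (h * real i) \<omega>)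
     borel (\<lambda>\<omega>. B (h * real (Suc n)) \<omega> - B (h * real n) \<omega>)"
  using assms by (intro indep_pair_past indep_increments[of "\<lambda>i. h * real i"]) auto

text \<open>
  The pair holds the distances of the walk from its running maximum and minimum; it is frozen once
  their sum, the range, exceeds \<open>2\<close>.
\<close>
definition range_move :: "real \<times> real \<Rightarrow> real \<Rightarrow> real \<times> real" where
  "range_move s x = (if fst s + snd s \<le> 2 then (max (fst s - x) 0, max (snd s + x) 0) else s)"

definition energy :: "real \<times> real \<Rightarrow> real" where
  "energy s = ((fst s)\<^sup>2 + (snd s)\<^sup>2) / 2"

lemma energy_nonneg: "0 \<le> energy s"
  by (simp add: energy_def)

lemma measurable_range_move: "case_prod range_move \<in> borel \<Otimes>\<^sub>M borel \<rightarrow>\<^sub>M borel"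
proof -
  have "(\<lambda>z. if fst (fst z) + snd (fst z) \<le> 2 then (max (fst (fst z) - snd z) 0, max (snd (fst z) + snd z) 0) else fst z)
      \<in> borel \<rightarrow>\<^sub>M (borel :: (real \<times> real) measure)"
  proof (rule measurable_If)
    have "closed {z :: (real \<times> real) \<times> real. fst (fst z) + snd (fst z) \<le> 2}"
      by (intro closed_Collect_le continuous_intros)
    then show "{z \<in> space borel. fst (fst z) + snd (fst z) \<le> 2} \<in> sets (borel :: ((real \<times> real) \<times> real) measure)"
      by simp
  qed (intro borel_measurable_continuous_onI continuous_intros)+
  moreover have "case_prod range_move = (\<lambda>z. if fst (fst z) + snd (fst z) \<le> 2 then (max (fst (fst z) - snd z) 0, max (snd (fst z) + snd z) 0) else fst z)"
    by (simp add: fun_eq_iff range_move_def)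
  ultimately show ?thesis by (simp add: borel_prod)
qed

lemma measurable_energy: "energy \<in> borel_measurable borel"
  unfolding energy_def by (intro borel_measurable_continuous_onI continuous_intros) simp

text \<open>The mean is zero, so the cross terms vanish, and the average of the two squares
  contributes the variance \<open>h\<close> once.\<close>

lemma normal_law_mean_square:
  assumes "0 < h"
  shows "(\<integral>\<^sup>+x. ennreal (((u - x)\<^sup>2 + (v + x)\<^sup>2) / 2) \<partial>normal_law h) = ennreal ((u\<^sup>2 + v\<^sup>2) / 2 + h)"
proof -
  have s: "0 < sqrt h" using assms by simp
  let ?g = "normal_density 0 (sqrt h)"
  have e: "?g x * (((u - x)\<^sup>2 + (v + x)\<^sup>2) / 2) = (u\<^sup>2 + v\<^sup>2) / 2 * ?g x + (v - u) * (?g x * x) + ?g x * x\<^sup>2" for x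
    by (simp add: power2_eq_square field_simps)
  have "has_bochner_integral lborel (\<lambda>x. ?g x * x\<^sup>2) h"
    using normal_moment_even[OF s, of 0 1] assms by simp
  moreover have "has_bochner_integral lborel (\<lambda>x. (v - u) * (?g x * x)) ((v - u) * 0)"
    by (intro has_bochner_integral_mult_right normal_moment_nz_1[OF s])
  moreover have "has_bochner_integral lborel (\<lambda>x. (u\<^sup>2 + v\<^sup>2) / 2 * ?g x) ((u\<^sup>2 + v\<^sup>2) / 2 * 1)"
    using normal_moment_even[OF s, of 0 0] by (intro has_bochner_integral_mult_right) simp
  ultimately have hb: "has_bochner_integral lborel (\<lambda>x. ?g x * (((u - x)\<^sup>2 + (v + x)\<^sup>2) / 2))
     ((u\<^sup>2 + v\<^sup>2) / 2 * 1 + (v - u) * 0 + h)"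
    unfolding e by (intro has_bochner_integral_add)
  have "(\<integral>\<^sup>+x. ennreal (((u - x)\<^sup>2 + (v + x)\<^sup>2) / 2) \<partial>normal_law h)
      = (\<integral>\<^sup>+x. ennreal (?g x * (((u - x)\<^sup>2 + (v + x)\<^sup>2) / 2)) \<partial>lborel)"
    by (subst nn_integral_density) (auto simp flip: ennreal_mult)
  also have "\<dots> = ennreal (LINT x|lborel. ?g x * (((u - x)\<^sup>2 + (v + x)\<^sup>2) / 2))"
    by (rule nn_integral_eq_integral[OF integrable.intros[OF hb]]) simp
  also have "(LINT x|lborel. ?g x * (((u - x)\<^sup>2 + (v + x)\<^sup>2) / 2)) = (u\<^sup>2 + v\<^sup>2) / 2 + h"
    using has_bochner_integral_integral_eq[OF hb] by (simp only: mult_1_right mult_zero_right add_0_right)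
  finally show ?thesis .
qed

text \<open>Truncation at zero can only lower a square, so a move adds at most \<open>h\<close> to
  the mean energy; a frozen state adds nothing.\<close>

lemma nn_integral_energy_range_move:
  assumes "0 < h"
  shows "(\<integral>\<^sup>+x. ennreal (energy (range_move s x)) \<partial>normal_law h)
      \<le> ennreal (energy s) + ennreal h * indicator {s. fst s + snd s \<le> 2} s"
proof -
  interpret prob_space "normal_law h" by (rule prob_space_normal_law[OF assms])
  show ?thesis
  proof (cases "fst s + snd s \<le> 2")
    case True
    have sq: "(max y 0)\<^sup>2 \<le> y\<^sup>2" for y :: real by (simp add: max_def)
    have "(\<integral>\<^sup>+x. ennreal (energy (range_move s x)) \<partial>normal_law h)
      \<le> (\<integral>\<^sup>+x. ennreal (((fst s - x)\<^sup>2 + (snd s + x)\<^sup>2) / 2) \<partial>normal_law h)"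
      using True by (intro nn_integral_mono ennreal_leI) (simp add: energy_def range_move_def add_mono sq)
    also have "\<dots> = ennreal (energy s + h)"
      unfolding energy_def by (rule normal_law_mean_square[OF assms])
    finally show ?thesis using True assms energy_nonneg by (simp add: ennreal_plus)
  next
    case False
    then have "(\<integral>\<^sup>+x. ennreal (energy (range_move s x)) \<partial>normal_law h) = (\<integral>\<^sup>+x. ennreal (energy s) \<partial>normal_law h)"
      by (simp add: range_move_def)
    also have "\<dots> = ennreal (energy s)"
      using emeasure_space_1 by (simp del: space_density)
    finally show ?thesis using False by simp
  qed
qed

text \<open>A discrete Dynkin inequality: summing the one-step estimate bounds the mean energy by
  the mean time spent before freezing.\<close>

lemma (in prob_space) expected_energy_bound:
  fixes X :: "nat \<Rightarrow> 'a \<Rightarrow> real"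
  assumes ind: "\<And>n. indep_pair (PiM {..<n} (\<lambda>_. borel)) (\<lambda>\<omega>. \<lambda>i\<in>{..<n}. X i \<omega>) borel (X n)"
    and law: "\<And>n. distr M borel (X n) = normal_law h" and "0 < h"
  defines "st \<equiv> \<lambda>n \<omega>. iterates range_move (0, 0) (\<lambda>i. X i \<omega>) n"
  shows "st n \<in> M \<rightarrow>\<^sub>M borel"
    and "(\<integral>\<^sup>+\<omega>. ennreal (energy (st n \<omega>)) \<partial>M)
      \<le> (\<integral>\<^sup>+\<omega>. (\<Sum>k<n. ennreal h * indicator {s. fst s + snd s \<le> 2} (st k \<omega>)) \<partial>M)"
proof -
  have indst: "indep_pair borel (st k) borel (X k)" for k
    unfolding st_def by (intro indep_pair_iterates measurable_range_move ind)
  then have st[measurable]: "st k \<in> M \<rightarrow>\<^sub>M borel" for k by (simp add: indep_pair_def)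
  then show "st n \<in> M \<rightarrow>\<^sub>M borel" .
  have "closed {s :: real \<times> real. fst s + snd s \<le> 2}"
    by (intro closed_Collect_le continuous_intros)
  then have [measurable]: "{s :: real \<times> real. fst s + snd s \<le> 2} \<in> sets borel" by simp
  note [measurable] = measurable_energy
  let ?I = "\<lambda>k \<omega>. ennreal h * indicator {s. fst s + snd s \<le> 2} (st k \<omega>)"
  show "(\<integral>\<^sup>+\<omega>. ennreal (energy (st n \<omega>)) \<partial>M) \<le> (\<integral>\<^sup>+\<omega>. (\<Sum>k<n. ?I k \<omega>) \<partial>M)"
  proof (induction n)
    case 0
    then show ?case by (simp add: st_def energy_def)
  next
    case (Suc n)
    have meas: "(\<lambda>z. ennreal (energy (case_prod range_move z))) \<in> borel_measurable (borel \<Otimes>\<^sub>M borel)"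
      by (intro measurable_compose[OF measurable_compose[OF measurable_range_move measurable_energy] measurable_ennreal])
    have "(\<integral>\<^sup>+\<omega>. ennreal (energy (st (Suc n) \<omega>)) \<partial>M) = (\<integral>\<^sup>+\<omega>. ennreal (energy (range_move (st n \<omega>) (X n \<omega>))) \<partial>M)"
      by (simp add: st_def)
    also have "\<dots> = (\<integral>\<^sup>+\<omega>. \<integral>\<^sup>+x. ennreal (energy (range_move (st n \<omega>) x)) \<partial>normal_law h \<partial>M)"
      using nn_integral_indep_pair[OF indst meas] by (simp add: law)
    also have "\<dots> \<le> (\<integral>\<^sup>+\<omega>. ennreal (energy (st n \<omega>)) + ?I n \<omega> \<partial>M)"
      by (intro nn_integral_mono nn_integral_energy_range_move \<open>0 < h\<close>)
    also have "\<dots> = (\<integral>\<^sup>+\<omega>. ennreal (energy (st n \<omega>)) \<partial>M) + (\<integral>\<^sup>+\<omega>. ?I n \<omega> \<partial>M)"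
      by (intro nn_integral_add) measurable
    also have "\<dots> \<le> (\<integral>\<^sup>+\<omega>. (\<Sum>k<n. ?I k \<omega>) \<partial>M) + (\<integral>\<^sup>+\<omega>. ?I n \<omega> \<partial>M)"
      by (intro add_right_mono Suc)
    also have "\<dots> = (\<integral>\<^sup>+\<omega>. (\<Sum>k<n. ?I k \<omega>) + ?I n \<omega> \<partial>M)"
      by (intro nn_integral_add[symmetric]) measurable
    finally show ?case by simp
  qed
qed

text \<open>As long as the range is at most \<open>2\<close>, every earlier value of the walk lies
  between the current value minus \<open>snd\<close> and the current value plus \<open>fst\<close>.
  Contrapositively, two grid values more than \<open>2\<close> apart force freezing.\<close>

lemma range_moves_bound_differences:
  fixes \<xi> :: "nat \<Rightarrow> real"
  defines "st \<equiv> iterates range_move (0, 0) \<xi>"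
  assumes "fst (st n) + snd (st n) \<le> 2" "i \<le> n" "j \<le> n"
  shows "sum \<xi> {..<i} - sum \<xi> {..<j} \<le> 2"
proof -
  have "fst (st n) + snd (st n) \<le> 2 \<Longrightarrow>
     \<forall>i\<le>n. sum \<xi> {..<i} \<le> sum \<xi> {..<n} + fst (st n) \<and> sum \<xi> {..<n} - snd (st n) \<le> sum \<xi> {..<i}"
  proof (induction n)
    case 0
    show ?case by (simp add: st_def)
  next
    case (Suc n)
    \<comment> \<open>A frozen state keeps its sum above \<open>2\<close>, so the previous state was
      not frozen.\<close>
    have alive: "fst (st n) + snd (st n) \<le> 2"
      using Suc.prems by (auto simp: st_def range_move_def split: if_splits)
    then have st: "st (Suc n) = (max (fst (st n) - \<xi> n) 0, max (snd (st n) + \<xi> n) 0)"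
      by (simp add: st_def range_move_def)
    show ?case
    proof (intro allI impI)
      fix i assume "i \<le> Suc n"
      show "sum \<xi> {..<i} \<le> sum \<xi> {..<Suc n} + fst (st (Suc n)) \<and>
          sum \<xi> {..<Suc n} - snd (st (Suc n)) \<le> sum \<xi> {..<i}"
      proof (cases "i = Suc n")
        case True
        then show ?thesis by (simp add: st)
      next
        case False
        then have "sum \<xi> {..<i} \<le> sum \<xi> {..<n} + fst (st n)" "sum \<xi> {..<n} - snd (st n) \<le> sum \<xi> {..<i}"
          using Suc.IH[OF alive] \<open>i \<le> Suc n\<close> by auto
        then show ?thesis by (simp add: st max_def)
      qed
    qed
  qed
  from this[OF assms(2)] have "sum \<xi> {..<i} \<le> sum \<xi> {..<n} + fst (st n)" "sum \<xi> {..<n} - snd (st n) \<le> sum \<xi> {..<j}"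
    using assms(3,4) by auto
  then show ?thesis using assms(2) by linarith
qed

text \<open>A move that truncates neither component leaves their sum unchanged. When the sum first
  exceeds \<open>2\<close>, one component is therefore zero and the other exceeds \<open>2\<close>,
  and freezing preserves this.\<close>

lemma energy_ge_2:
  fixes \<xi> :: "nat \<Rightarrow> real"
  defines "st \<equiv> iterates range_move (0, 0) \<xi>"
  assumes "2 < fst (st n) + snd (st n)"
  shows "2 \<le> energy (st n)"
proof -
  have "2 < fst (st n) + snd (st n) \<Longrightarrow> fst (st n) = 0 \<or> snd (st n) = 0"
  proof (induction n)
    case 0
    then show ?case by (simp add: st_def)
  next
    case (Suc n)
    then show ?case
      by (cases "fst (st n) + snd (st n) \<le> 2") (auto simp: st_def range_move_def max_def split: if_splits)
  qed
  with assms(2) have "fst (st n) = 0 \<and> 2 < snd (st n) \<or> snd (st n) = 0 \<and> 2 < fst (st n)" by auto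
  moreover have "2 < a \<Longrightarrow> 4 \<le> a\<^sup>2" for a :: real
    using power_mono[of 2 a 2] by simp
  ultimately show ?thesis by (auto simp: energy_def)
qed

section \<open>The upper bound\<close>

context standard_planar_brownian_motion
begin

definition planar_step :: "real \<Rightarrow> nat \<Rightarrow> 'a \<Rightarrow> real \<times> real" where
  "planar_step h n \<omega> = (W (h * real (Suc n)) \<omega> $ 1 - W (h * real n) \<omega> $ 1,
                         W (h * real (Suc n)) \<omega> $ 2 - W (h * real n) \<omega> $ 2)"

lemma planar_step_indep_law:
  assumes "0 < h"
  shows "indep_pair (PiM {..<n} (\<lambda>_. borel)) (\<lambda>\<omega>. \<lambda>i\<in>{..<n}. planar_step h i \<omega>) borel (planar_step h n)"
    and "distr M borel (planar_step h n) = planar_normal_law h"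
proof -
  interpret B1: standard_brownian_motion M "\<lambda>t \<omega>. W t \<omega> $ 1" by (rule coord1)
  interpret B2: standard_brownian_motion M "\<lambda>t \<omega>. W t \<omega> $ 2" by (rule coord2)
  define x where "x i \<omega> = W (h * real (Suc i)) \<omega> $ 1 - W (h * real i) \<omega> $ 1" for i \<omega>
  define y where "y i \<omega> = W (h * real (Suc i)) \<omega> $ 2 - W (h * real i) \<omega> $ 2" for i \<omega>
  \<comment> \<open>A measurable map on path space reading off the past increments and the next one;
    through it the independence of the coordinate processes passes to these increments.\<close>
  define F where "F p = ((\<lambda>i\<in>{..<n}. p (h * real (Suc i)) - p (h * real i)), p (h * real (Suc n)) - p (h * real n))"
    for p :: "real \<Rightarrow> real"
  have comp: "(\<lambda>p. p (h * real k)) \<in> PiM {0..} (\<lambda>_. borel) \<rightarrow>\<^sub>M (borel :: real measure)" for k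
    using assms by (intro measurable_component_singleton) simp
  have F: "F \<in> PiM {0..} (\<lambda>_. borel) \<rightarrow>\<^sub>M PiM {..<n} (\<lambda>_. borel) \<Otimes>\<^sub>M borel"
    unfolding F_def by (intro measurable_Pair measurable_restrict borel_measurable_diff comp)
  have Fx: "F (\<lambda>t\<in>{0..}. W t \<omega> $ 1) = ((\<lambda>i\<in>{..<n}. x i \<omega>), x n \<omega>)" for \<omega>
    using assms by (auto simp: F_def x_def fun_eq_iff)
  have Fy: "F (\<lambda>t\<in>{0..}. W t \<omega> $ 2) = ((\<lambda>i\<in>{..<n}. y i \<omega>), y n \<omega>)" for \<omega>
    using assms by (auto simp: F_def y_def fun_eq_iff)
  have xy: "indep_pair (PiM {..<n} (\<lambda>_. borel) \<Otimes>\<^sub>M borel) (\<lambda>\<omega>. ((\<lambda>i\<in>{..<n}. x i \<omega>), x n \<omega>))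
      (PiM {..<n} (\<lambda>_. borel) \<Otimes>\<^sub>M borel) (\<lambda>\<omega>. ((\<lambda>i\<in>{..<n}. y i \<omega>), y n \<omega>))"
    using indep_pair_compose[OF indep_var_imp_indep_pair[OF indep_coords] F F] unfolding Fx Fy .
  have xx: "indep_pair (PiM {..<n} (\<lambda>_. borel)) (\<lambda>\<omega>. \<lambda>i\<in>{..<n}. x i \<omega>) borel (x n)"
    unfolding x_def using assms by (rule B1.indep_grid_increments)
  have yy: "indep_pair (PiM {..<n} (\<lambda>_. borel)) (\<lambda>\<omega>. \<lambda>i\<in>{..<n}. y i \<omega>) borel (y n)"
    unfolding y_def using assms by (rule B2.indep_grid_increments)
  note inter = indep_pair_interchange[OF xx yy xy]
  have step: "planar_step h i = (\<lambda>\<omega>. (x i \<omega>, y i \<omega>))" for i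
    by (simp add: planar_step_def x_def y_def fun_eq_iff)
  define G where "G = (\<lambda>(p, q). \<lambda>i\<in>{..<n}. (p i, q i :: real) :: real \<times> real)"
  have G: "G \<in> PiM {..<n} (\<lambda>_. borel) \<Otimes>\<^sub>M PiM {..<n} (\<lambda>_. borel) \<rightarrow>\<^sub>M PiM {..<n} (\<lambda>_. borel)"
    unfolding G_def split_beta borel_prod[symmetric]
    by (intro measurable_restrict measurable_Pair
        measurable_compose[OF measurable_fst measurable_component_singleton]
        measurable_compose[OF measurable_snd measurable_component_singleton])
  have "(\<lambda>\<omega>. \<lambda>i\<in>{..<n}. planar_step h i \<omega>) = (\<lambda>\<omega>. G ((\<lambda>i\<in>{..<n}. x i \<omega>), (\<lambda>i\<in>{..<n}. y i \<omega>)))"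
    by (auto simp: G_def step fun_eq_iff)
  then show "indep_pair (PiM {..<n} (\<lambda>_. borel)) (\<lambda>\<omega>. \<lambda>i\<in>{..<n}. planar_step h i \<omega>) borel (planar_step h n)"
    using indep_pair_compose[OF inter(1) G measurable_ident] by (simp add: step borel_prod)
  have "distr M borel (x n) = normal_law h" "distr M borel (y n) = normal_law h"
  proof -
    have "h * real (Suc n) - h * real n = h" "h * real n < h * real (Suc n)" "0 \<le> h * real n"
      using assms by (auto simp: algebra_simps)
    then show "distr M borel (x n) = normal_law h" "distr M borel (y n) = normal_law h"
      using B1.distr_increment[of "h * real n" "h * real (Suc n)"] B2.distr_increment[of "h * real n" "h * real (Suc n)"]
      unfolding x_def[abs_def] y_def[abs_def] by metis+
  qed
  then show "distr M borel (planar_step h n) = planar_normal_law h"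
    using inter(2) by (simp add: indep_pair_def step borel_prod)
qed

lemma AE_continuous_from_zero: "AE \<omega> in M. W 0 \<omega> = 0 \<and> continuous_on {0..} (\<lambda>t. W t \<omega>)"
proof -
  interpret B1: standard_brownian_motion M "\<lambda>t \<omega>. W t \<omega> $ 1" by (rule coord1)
  interpret B2: standard_brownian_motion M "\<lambda>t \<omega>. W t \<omega> $ 2" by (rule coord2)
  show ?thesis
    using B1.start_zero B2.start_zero B1.continuous_paths B2.continuous_paths
  proof eventually_elim
    case (elim \<omega>)
    have "continuous_on {0..} (\<lambda>t. \<chi> i. W t \<omega> $ i)"
      using elim(3,4) by (intro continuous_on_vec_lambda) (metis exhaust_2)
    moreover have "W 0 \<omega> = 0"
      using elim(1,2) by (simp add: vec_eq_iff forall_2)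
    ultimately show ?case by simp
  qed
qed

end

lemma bounded_path_hull:
  assumes "continuous_on {0..} (\<lambda>t. W t \<omega>)"
  shows "bounded (path_hull W \<omega> t)"
  unfolding path_hull_def
  by (intro bounded_convex_hull compact_imp_bounded compact_continuous_image continuous_on_subset[OF assms]) auto

context standard_planar_brownian_motion
begin

text \<open>The vertices of the triangle are points of the path visited by time
  \<open>7 * n\<close>, so the hull at that time contains the disc of radius above
  \<open>1\<close>.\<close>

lemma inradius_time_le_success:
  assumes "W 0 \<omega> = 0" and cont: "continuous_on {0..} (\<lambda>t. W t \<omega>)"
    and success: "success (iterates update_triple (0, 0, 0) (\<lambda>i. planar_step 7 i \<omega>) n)"
  shows "inradius_time W \<omega> \<le> ennreal (7 * real n)"
proof -
  define st where "st = iterates update_triple (0, 0, 0) (\<lambda>i. planar_step 7 i \<omega>)"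
  define pos where "pos k = Complex (W (7 * real k) \<omega> $ 1) (W (7 * real k) \<omega> $ 2)" for k
  define A where "A k = {z. plane_of z \<in> (\<lambda>s. W s \<omega>) ` {0..7 * real k}}" for k
  have plane_pos: "plane_of (pos k) = W (7 * real k) \<omega>" for k
    by (simp add: vec_eq_iff forall_2 pos_def)
  have posA: "pos k \<in> A k" for k
    unfolding A_def mem_Collect_eq plane_pos by (intro imageI) simp
  have A_mono: "A k \<subseteq> A (Suc k)" for k
    unfolding A_def by (intro Collect_mono impI) (erule rev_subsetD, intro image_mono, simp)
  have pos_Suc: "pos k + complex_of_pair (planar_step 7 k \<omega>) = pos (Suc k)" for k
    by (simp add: complex_eq_iff pos_def planar_step_def)
  \<comment> \<open>The third component is the current position until the triple is frozen;
    afterwards it is only known to have been visited.\<close>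
  have inv: "case st k of (P, Q, Z) \<Rightarrow> P \<in> A k \<and> Q \<in> A k \<and> Z \<in> A k \<and> (wide_triangle P Q Z \<or> Z = pos k)" for k
  proof (induction k)
    case 0
    have "pos 0 = 0" using assms(1) by (simp add: pos_def complex_eq_iff)
    then show ?case using posA[of 0] by (simp add: st_def)
  next
    case (Suc k)
    obtain P Q Z where s: "st k = (P, Q, Z)" by (cases "st k")
    have st_Suc: "st (Suc k) = update_triple (P, Q, Z) (planar_step 7 k \<omega>)"
      using s by (simp add: st_def)
    have mem: "P \<in> A (Suc k)" "Q \<in> A (Suc k)" "Z \<in> A (Suc k)"
      using Suc A_mono[of k] unfolding s by auto
    show ?case
    proof (cases "wide_triangle P Q Z")
      case True
      then have "st (Suc k) = (P, Q, Z)" unfolding st_Suc update_triple_def by simp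
      then show ?thesis using mem True by simp
    next
      case False
      then have Z': "Z + complex_of_pair (planar_step 7 k \<omega>) = pos (Suc k)"
        using Suc unfolding s by (simp add: pos_Suc)
      have "st (Suc k) \<in> {P, Q, Z} \<times> {Q, pos (Suc k)} \<times> {pos (Suc k)}"
        unfolding st_Suc update_triple_def prod.case Let_def Z' using False by simp
      then show ?thesis using mem posA[of "Suc k"] by auto
    qed
  qed
  obtain P Q Z where s: "st n = (P, Q, Z)" by (cases "st n")
  have wide: "wide_triangle P Q Z" using success s by (simp add: success_def st_def)
  then obtain c \<rho> where c: "1 < \<rho>" "cball c \<rho> \<subseteq> convex hull {P, Q, Z}"
    using wide_triangle_contains_disc by blast
  have "cball (plane_of c) \<rho> \<subseteq> plane_of ` (convex hull {P, Q, Z})"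
    unfolding plane_of_cball[symmetric] using c(2) by (rule image_mono)
  also have "\<dots> = convex hull (plane_of ` {P, Q, Z})"
    by (rule convex_hull_linear_image[OF linear_plane_of])
  also have "\<dots> \<subseteq> path_hull W \<omega> (7 * real n)"
    unfolding path_hull_def
  proof (rule hull_mono)
    show "plane_of ` {P, Q, Z} \<subseteq> (\<lambda>s. W s \<omega>) ` {0..7 * real n}"
      using inv[of n] unfolding s A_def by auto
  qed
  finally have "1 < inradius (path_hull W \<omega> (7 * real n))"
    by (rule less_inradius[OF _ bounded_path_hull[of W \<omega>, OF cont] c(1)])
  then show ?thesis
    unfolding inradius_time_def by (intro INF_lower) simp
qed

text \<open>Pathwise the time is at most \<open>7\<close> times the number of failing states, and in
  expectation \<open>7 * 154 / 13 < 83.4\<close>.\<close>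

lemma expectation_inradius_time_le: "(\<integral>\<^sup>+\<omega>. inradius_time W \<omega> \<partial>M) \<le> ennreal 83.4"
proof -
  define st where "st = (\<lambda>n \<omega>. iterates update_triple (0, 0, 0) (\<lambda>i. planar_step 7 i \<omega>) n)"
  define A where "A n = {\<omega> \<in> space M. \<not> success (st n \<omega>)}" for n
  have ind: "indep_pair borel (st n) borel (planar_step 7 n)" for n
    unfolding st_def by (intro indep_pair_iterates measurable_update_triple planar_step_indep_law) simp
  have failure_sets: "{s. \<not> success s} \<in> sets borel"
    using borel_comp[OF borel_closed[OF closed_success]] by (simp add: Collect_neg_eq)
  have A: "A n \<in> sets M" for n
  proof -
    have "st n -` {s. \<not> success s} \<inter> space M \<in> sets M"
      using ind[of n] failure_sets by (intro measurable_sets) (auto simp: indep_pair_def)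
    moreover have "st n -` {s. \<not> success s} \<inter> space M = A n" by (auto simp: A_def)
    ultimately show ?thesis by simp
  qed
  have "AE \<omega> in M. inradius_time W \<omega> \<le> (\<Sum>n. ennreal 7 * indicator (A n) \<omega>)"
    using AE_continuous_from_zero AE_space
  proof eventually_elim
    case (elim \<omega>)
    show ?case
    proof (cases "\<exists>n. success (st n \<omega>)")
      case True
      define m where "m = (LEAST n. success (st n \<omega>))"
      have "success (st m \<omega>)" unfolding m_def using True by (rule LeastI_ex)
      then have "inradius_time W \<omega> \<le> ennreal (7 * real m)"
        using elim unfolding st_def by (intro inradius_time_le_success) auto
      also have "\<dots> = (\<Sum>n<m. ennreal 7 * indicator (A n) \<omega>)"
      proof -
        have "indicator (A n) \<omega> = (1 :: ennreal)" if "n < m" for n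
          using not_less_Least[of n "\<lambda>n. success (st n \<omega>)"] that elim by (simp add: m_def A_def)
        then show ?thesis by (simp add: ennreal_mult ennreal_of_nat_eq_real_of_nat mult.commute)
      qed
      also have "\<dots> \<le> (\<Sum>n. ennreal 7 * indicator (A n) \<omega>)"
        by (intro sum_le_suminf) auto
      finally show ?thesis .
    next
      case False
      then have "indicator (A n) \<omega> = (1 :: ennreal)" for n
        using elim by (simp add: A_def)
      \<comment> \<open>Without any success the partial sums are unbounded, so the bounding series
        is infinite and the estimate is trivial.\<close>
      then have ind: "(\<Sum>n<m. ennreal 7 * indicator (A n) \<omega>) = of_nat m * 7" for m
        by simp
      have "of_nat m \<le> (\<Sum>n. ennreal 7 * indicator (A n) \<omega>)" for m
      proof -
        have "of_nat m \<le> (of_nat m * 7 :: ennreal)"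
          using mult_left_mono[of 1 "7 :: ennreal" "of_nat m"] by simp
        also have "\<dots> \<le> (\<Sum>n. ennreal 7 * indicator (A n) \<omega>)"
          unfolding ind[symmetric] by (intro sum_le_suminf) auto
        finally show ?thesis .
      qed
      then have "(\<Sum>n. ennreal 7 * indicator (A n) \<omega>) = top"
        using ennreal_Ex_less_of_nat by (metis not_le top.not_eq_extremum)
      then show ?thesis by simp
    qed
  qed
  then have "(\<integral>\<^sup>+\<omega>. inradius_time W \<omega> \<partial>M) \<le> (\<integral>\<^sup>+\<omega>. (\<Sum>n. ennreal 7 * indicator (A n) \<omega>) \<partial>M)"
    by (rule nn_integral_mono_AE)
  also have "\<dots> = (\<Sum>n. \<integral>\<^sup>+\<omega>. ennreal 7 * indicator (A n) \<omega> \<partial>M)"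
    using A by (intro nn_integral_suminf) simp
  also have "\<dots> = (\<Sum>n. ennreal 7 * emeasure M (A n))"
    using A by (simp add: nn_integral_cmult_indicator)
  also have "\<dots> \<le> ennreal 83.4"
  proof (rule suminf_le_const)
    fix n
    have "(\<Sum>k<n. prob (A k)) \<le> 154 / 13"
      unfolding A_def st_def
      by (rule expected_steps_bound[where X = "planar_step 7"]) (simp_all add: planar_step_indep_law)
    then have "7 * (\<Sum>k<n. prob (A k)) \<le> 83.4" by simp
    moreover have "(\<Sum>k<n. ennreal 7 * emeasure M (A k)) = ennreal (7 * (\<Sum>k<n. prob (A k)))"
    proof -
      have "ennreal 7 * emeasure M (A k) = ennreal (7 * prob (A k))" for k
        by (simp add: emeasure_eq_measure ennreal_mult)
      then show ?thesis by (simp add: sum_distrib_left sum_ennreal)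
    qed
    ultimately show "(\<Sum>k<n. ennreal 7 * emeasure M (A k)) \<le> ennreal 83.4"
      by (simp only: ennreal_leI)
  qed simp
  finally show ?thesis .
qed

end

section \<open>The lower bound\<close>

text \<open>The density is at most \<open>1 / sqrt (2 * pi * T)\<close>, so \<open>[-2, 2]\<close>
  has mass at most \<open>4\<close> times this. For large \<open>T\<close> the range thus exceeds
  \<open>2\<close> by time \<open>T\<close> with probability close to \<open>1\<close>.\<close>

lemma (in standard_brownian_motion) prob_large_increment:
  assumes "0 < T"
  shows "1 - 4 / sqrt (2 * pi * T) \<le> prob {\<omega> \<in> space M. 2 < \<bar>B T \<omega> - B 0 \<omega>\<bar>}"
proof -
  interpret N: prob_space "normal_law T" by (rule prob_space_normal_law[OF assms])
  let ?D = "\<lambda>\<omega>. B T \<omega> - B 0 \<omega>"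
  have D: "?D \<in> borel_measurable M"
    using random_variable[of T] random_variable[of 0] assms by simp
  have "measure (normal_law T) {-2..2} = integral {-2..2} (normal_density 0 (sqrt T))"
    by (simp add: measure_def emeasure_normal_law_Icc[OF assms] Henstock_Kurzweil_Integration.integral_nonneg
        integrable_continuous_real continuous_on_normal_density)
  also have "\<dots> \<le> integral {-2..2 :: real} (\<lambda>_. 1 / sqrt (2 * pi * T))"
  proof (rule integral_le)
    show "normal_density 0 (sqrt T) x \<le> 1 / sqrt (2 * pi * T)" for x
      using assms by (simp add: normal_density_def divide_right_mono)
  qed (auto intro!: integrable_continuous_real continuous_on_normal_density)
  also have "\<dots> = 4 / sqrt (2 * pi * T)" by simp
  finally have small: "measure (normal_law T) {-2..2} \<le> 4 / sqrt (2 * pi * T)" .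
  have "prob {\<omega> \<in> space M. 2 < \<bar>?D \<omega>\<bar>} = measure (distr M borel ?D) (- {-2..2})"
  proof (subst measure_distr[OF D])
    show "prob {\<omega> \<in> space M. 2 < \<bar>?D \<omega>\<bar>} = prob (?D -` (- {- 2..2}) \<inter> space M)"
      by (intro arg_cong[where f=prob]) auto
  qed simp
  also have "distr M borel ?D = normal_law T"
    using distr_increment[of 0 T] assms by simp
  also have "measure (normal_law T) (- {-2..2}) = 1 - measure (normal_law T) {-2..2}"
    using N.prob_compl[of "{-2..2}"] by (simp add: Compl_eq_Diff_UNIV)
  finally show ?thesis using small by simp
qed

section \<open>From grids to the continuous path\<close>

lemma grid_below_le:
  assumes "0 < h" "0 \<le> s"
  shows "h * real (nat \<lfloor>s / h\<rfloor>) \<le> s"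
proof -
  have "real (nat \<lfloor>s / h\<rfloor>) \<le> s / h" using assms by simp
  from mult_left_mono[OF this, of h] assms show ?thesis by simp
qed

lemma grid_below_tendsto:
  assumes "0 < T" "0 \<le> s"
  shows "(\<lambda>m. T / real (Suc m) * real (nat \<lfloor>s / (T / real (Suc m))\<rfloor>)) \<longlonglongrightarrow> s"
proof (rule tendsto_sandwich[where h = "\<lambda>_. s"])
  have "(\<lambda>m. s - T * inverse (real (Suc m))) \<longlonglongrightarrow> s - T * 0"
    by (intro tendsto_intros LIMSEQ_inverse_real_of_nat)
  then show "(\<lambda>m. s - T / real (Suc m)) \<longlonglongrightarrow> s" by (simp add: divide_inverse)
  show "\<forall>\<^sub>F m in sequentially. s - T / real (Suc m) \<le> T / real (Suc m) * real (nat \<lfloor>s / (T / real (Suc m))\<rfloor>)"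
  proof (intro always_eventually allI)
    fix m
    define h where "h = T / real (Suc m)"
    have h: "0 < h" using assms by (simp add: h_def)
    have "s / h - 1 \<le> real (nat \<lfloor>s / h\<rfloor>)" using assms h by linarith
    from mult_left_mono[OF this, of h] h show "s - h \<le> h * real (nat \<lfloor>s / h\<rfloor>)"
      by (simp add: right_diff_distrib)
  qed
  show "\<forall>\<^sub>F m in sequentially. T / real (Suc m) * real (nat \<lfloor>s / (T / real (Suc m))\<rfloor>) \<le> s"
    using assms by (intro always_eventually allI grid_below_le) simp_all
qed simp

text \<open>The hull lies in the vertical strip between the extreme first coordinates of the path,
  and a disc of radius above \<open>1\<close> has horizontal diameter above
  \<open>2\<close>.\<close>

lemma inradius_gt_1_imp_wide:
  fixes W :: "real \<Rightarrow> 'a \<Rightarrow> real ^ 2"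
  assumes cont: "continuous_on {0..} (\<lambda>t. W t \<omega>)" and "0 \<le> t" and inr: "1 < inradius (path_hull W \<omega> t)"
  shows "\<exists>r\<in>{0..t}. \<exists>s\<in>{0..t}. 2 < W r \<omega> $ 1 - W s \<omega> $ 1"
proof -
  define S where "S = {\<rho>. 0 \<le> \<rho> \<and> (\<exists>c. cball c \<rho> \<subseteq> path_hull W \<omega> t)}"
  have "W 0 \<omega> \<in> path_hull W \<omega> t"
    unfolding path_hull_def using \<open>0 \<le> t\<close> by (intro hull_inc imageI) simp
  \<comment> \<open>The degenerate disc makes the set of radii nonempty, so a supremum above
    \<open>1\<close> provides an actual radius above \<open>1\<close>.\<close>
  then have "cball (W 0 \<omega>) 0 \<subseteq> path_hull W \<omega> t" by simp
  then have "0 \<in> S" unfolding S_def by blast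
  then have "S \<noteq> {}" by blast
  moreover have "1 < Sup S" using inr unfolding inradius_def S_def .
  ultimately obtain \<rho> where \<rho>: "\<rho> \<in> S" "1 < \<rho>"
    by (metis less_cSupE)
  then obtain c where c: "cball c \<rho> \<subseteq> path_hull W \<omega> t" unfolding S_def by blast
  have cont1: "continuous_on {0..t} (\<lambda>s. W s \<omega> $ 1)"
    by (intro continuous_intros continuous_on_subset[OF cont]) auto
  obtain r where r: "r \<in> {0..t}" "\<And>s. s \<in> {0..t} \<Longrightarrow> W s \<omega> $ 1 \<le> W r \<omega> $ 1"
    using continuous_attains_sup[OF compact_Icc _ cont1] \<open>0 \<le> t\<close> by auto
  obtain s where s: "s \<in> {0..t}" "\<And>r. r \<in> {0..t} \<Longrightarrow> W s \<omega> $ 1 \<le> W r \<omega> $ 1"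
    using continuous_attains_inf[OF compact_Icc _ cont1] \<open>0 \<le> t\<close> by auto
  have "path_hull W \<omega> t \<subseteq> {p. W s \<omega> $ 1 \<le> p $ 1} \<inter> {p. p $ 1 \<le> W r \<omega> $ 1}"
    unfolding path_hull_def
  proof (rule hull_minimal)
    show "(\<lambda>s. W s \<omega>) ` {0..t} \<subseteq> {p. W s \<omega> $ 1 \<le> p $ 1} \<inter> {p. p $ 1 \<le> W r \<omega> $ 1}"
      using r s by auto
    have "{p :: real ^ 2. W s \<omega> $ 1 \<le> p $ 1} = {p. W s \<omega> $ 1 \<le> axis 1 1 \<bullet> p}"
      "{p :: real ^ 2. p $ 1 \<le> W r \<omega> $ 1} = {p. axis 1 1 \<bullet> p \<le> W r \<omega> $ 1}"
      by (simp_all add: inner_axis inner_commute)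
    then have "convex {p :: real ^ 2. W s \<omega> $ 1 \<le> p $ 1}" "convex {p :: real ^ 2. p $ 1 \<le> W r \<omega> $ 1}"
      using convex_halfspace_ge[of "W s \<omega> $ 1" "axis 1 1 :: real ^ 2"]
        convex_halfspace_le[of "axis 1 1 :: real ^ 2" "W r \<omega> $ 1"] by simp_all
    then show "convex ({p :: real ^ 2. W s \<omega> $ 1 \<le> p $ 1} \<inter> {p. p $ 1 \<le> W r \<omega> $ 1})"
      by (rule convex_Int)
  qed
  moreover have "c + \<rho> *\<^sub>R axis 1 1 \<in> cball c \<rho>" "c - \<rho> *\<^sub>R axis 1 1 \<in> cball c \<rho>"
    using \<rho>(2) by (simp_all add: dist_norm)
  ultimately have "c + \<rho> *\<^sub>R axis 1 1 \<in> {p. p $ 1 \<le> W r \<omega> $ 1}" "c - \<rho> *\<^sub>R axis 1 1 \<in> {p. W s \<omega> $ 1 \<le> p $ 1}"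
    using c by blast+
  then have "c $ 1 + \<rho> \<le> W r \<omega> $ 1" "W s \<omega> $ 1 \<le> c $ 1 - \<rho>" by simp_all
  then have "2 < W r \<omega> $ 1 - W s \<omega> $ 1" using \<rho>(2) by linarith
  then show ?thesis using r(1) s(1) by blast
qed

text \<open>The time the walk sampled with mesh \<open>T / (m + 1)\<close> spends before its range
  exceeds \<open>2\<close>, counted only up to the horizon \<open>T\<close>.\<close>

definition grid_clock :: "(real \<Rightarrow> real) \<Rightarrow> real \<Rightarrow> nat \<Rightarrow> ennreal" where
  "grid_clock b T m = (\<Sum>k<Suc m. ennreal (T / real (Suc m)) * indicator {s. fst s + snd s \<le> 2}
     (iterates range_move (0, 0) (\<lambda>i. b (T / real (Suc m) * real (Suc i)) - b (T / real (Suc m) * real i)) k))"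

text \<open>By continuity the path at the grid points just below \<open>r\<close> and
  \<open>s\<close> also has a gap above \<open>2\<close> once the mesh is small, and the clock has
  then stopped.\<close>

lemma limsup_grid_clock_le:
  assumes cont: "continuous_on {0..} b" and "0 < T"
    and r: "0 \<le> r" "r \<le> t" and s: "0 \<le> s" "s \<le> t" and gap: "2 < b r - b s"
  shows "limsup (grid_clock b T) \<le> ennreal t"
proof (rule Limsup_bounded)
  define h where "h m = T / real (Suc m)" for m
  define i where "i m = nat \<lfloor>r / h m\<rfloor>" for m
  define j where "j m = nat \<lfloor>s / h m\<rfloor>" for m
  have h: "0 < h m" for m using \<open>0 < T\<close> by (simp add: h_def)
  have lim: "(\<lambda>m. b (h m * real (nat \<lfloor>u / h m\<rfloor>))) \<longlonglongrightarrow> b u" if "0 \<le> u" for u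
  proof (rule continuous_on_tendsto_compose[OF cont])
    show "(\<lambda>m. h m * real (nat \<lfloor>u / h m\<rfloor>)) \<longlonglongrightarrow> u"
      unfolding h_def by (rule grid_below_tendsto[OF \<open>0 < T\<close> that])
    show "u \<in> {0..}" using that by simp
    show "\<forall>\<^sub>F m in sequentially. h m * real (nat \<lfloor>u / h m\<rfloor>) \<in> {0..}"
      using h by (intro always_eventually allI) (simp add: less_imp_le)
  qed
  have "(\<lambda>m. b (h m * real (i m)) - b (h m * real (j m))) \<longlonglongrightarrow> b r - b s"
    unfolding i_def j_def by (intro tendsto_diff lim r s)
  then have "\<forall>\<^sub>F m in sequentially. 2 < b (h m * real (i m)) - b (h m * real (j m))"
    by (rule order_tendstoD(1)) (rule gap)
  then show "\<forall>\<^sub>F m in sequentially. grid_clock b T m \<le> ennreal t"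
  proof eventually_elim
    case (elim m)
    define \<xi> where "\<xi> k = b (h m * real (Suc k)) - b (h m * real k)" for k
    define st where "st = iterates range_move (0, 0) \<xi>"
    have sum: "sum \<xi> {..<k} = b (h m * real k) - b 0" for k
      unfolding \<xi>_def using sum_lessThan_telescope[of "\<lambda>k. b (h m * real k)" k] by simp
    \<comment> \<open>The later of the two grid indices. As \<open>r\<close> and \<open>s\<close>
      are rounded down, \<open>h m * K \<le> t\<close> without a mesh error.\<close>
    define K where "K = max (i m) (j m)"
    have dead: "2 < fst (st k) + snd (st k)" if "K \<le> k" for k
      using range_moves_bound_differences[of \<xi> k "i m" "j m"] that elim unfolding st_def sum K_def by fastforce
    have "grid_clock b T m = (\<Sum>k<Suc m. ennreal (h m) * indicator {s. fst s + snd s \<le> 2} (st k))"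
      unfolding grid_clock_def h_def[symmetric] \<xi>_def[symmetric] st_def[symmetric] ..
    also have "\<dots> \<le> (\<Sum>k<Suc m. ennreal (h m) * indicator {..<K} k)"
      using dead by (intro sum_mono mult_left_mono) (auto simp: indicator_def not_less[symmetric])
    also have "\<dots> = (\<Sum>k\<in>{..<Suc m} \<inter> {..<K}. ennreal (h m))"
      by (intro sum.mono_neutral_cong_right) (auto simp: indicator_def)
    also have "\<dots> \<le> (\<Sum>k<K. ennreal (h m))"
      by (intro sum_mono2) auto
    also have "\<dots> = ennreal (h m * real K)"
      using h[of m] by (simp add: ennreal_of_nat_eq_real_of_nat ennreal_mult mult.commute less_imp_le)
    also have "\<dots> \<le> ennreal t"
      using grid_below_le[OF h[of m] r(1)] grid_below_le[OF h[of m] s(1)] r(2) s(2)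
      by (intro ennreal_leI) (auto simp: K_def max_def i_def j_def)
    finally show ?case .
  qed
qed

context standard_planar_brownian_motion
begin

text \<open>The mean clock is at least the mean energy at time \<open>T\<close>, which is at least
  twice the probability of a net displacement above \<open>2\<close>. The reverse Fatou lemma
  carries this to the limsup of the clocks, which is pathwise at most the inradius time.\<close>

lemma expectation_inradius_time_ge_horizon:
  assumes "0 < T"
  shows "ennreal (2 * (1 - 4 / sqrt (2 * pi * T))) \<le> (\<integral>\<^sup>+\<omega>. inradius_time W \<omega> \<partial>M)"
proof -
  interpret B: standard_brownian_motion M "\<lambda>t \<omega>. W t \<omega> $ 1" by (rule coord1)
  define b where "b \<omega> = (\<lambda>t. W t \<omega> $ 1)" for \<omega>
  define h where "h m = T / real (Suc m)" for m
  have h: "0 < h m" for m using assms by (simp add: h_def)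
  define X where "X m i \<omega> = b \<omega> (h m * real (Suc i)) - b \<omega> (h m * real i)" for m i \<omega>
  define st where "st m k \<omega> = iterates range_move (0, 0) (\<lambda>i. X m i \<omega>) k" for m k \<omega>
  have clock: "grid_clock (b \<omega>) T m = (\<Sum>k<Suc m. ennreal (h m) * indicator {s. fst s + snd s \<le> 2} (st m k \<omega>))" for \<omega> m
    by (simp only: grid_clock_def st_def X_def h_def)
  have ind: "indep_pair (PiM {..<n} (\<lambda>_. borel)) (\<lambda>\<omega>. \<lambda>i\<in>{..<n}. X m i \<omega>) borel (X m n)" for m n
    unfolding X_def b_def by (rule B.indep_grid_increments[OF h])
  have law: "distr M borel (X m n) = normal_law (h m)" for m n
  proof -
    have "h m * real (Suc n) - h m * real n = h m" "h m * real n < h m * real (Suc n)" "0 \<le> h m * real n"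
      using h[of m] by (auto simp: algebra_simps)
    then show ?thesis
      using B.distr_increment[of "h m * real n" "h m * real (Suc n)"] unfolding X_def[abs_def] b_def by metis
  qed
  note en = expected_energy_bound[where X="X m" and h="h m" for m, OF ind law h, folded st_def]
  have st[measurable]: "st m k \<in> M \<rightarrow>\<^sub>M borel" for m k
    using en(1)[of m k] unfolding st_def[abs_def] .
  have "closed {s :: real \<times> real. fst s + snd s \<le> 2}"
    by (intro closed_Collect_le continuous_intros)
  then have [measurable]: "{s :: real \<times> real. fst s + snd s \<le> 2} \<in> sets borel" by simp
  have meas: "(\<lambda>\<omega>. grid_clock (b \<omega>) T m) \<in> borel_measurable M" for m
    unfolding clock by measurable
  define A where "A = {\<omega> \<in> space M. 2 < \<bar>b \<omega> T - b \<omega> 0\<bar>}"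
  note [measurable] = B.random_variable[OF less_imp_le[OF assms]] B.random_variable[OF order_refl]
  have A: "A \<in> sets M"
    unfolding A_def b_def by measurable
  have lower: "ennreal (2 * (1 - 4 / sqrt (2 * pi * T))) \<le> (\<integral>\<^sup>+\<omega>. grid_clock (b \<omega>) T m \<partial>M)" for m
  proof -
    have "1 - 4 / sqrt (2 * pi * T) \<le> prob A"
      unfolding A_def b_def by (rule B.prob_large_increment[OF assms])
    then have "ennreal (2 * (1 - 4 / sqrt (2 * pi * T))) \<le> ennreal (2 * prob A)"
      by (intro ennreal_leI) simp
    also have "\<dots> = (\<integral>\<^sup>+\<omega>. 2 * indicator A \<omega> \<partial>M)"
      using A by (simp add: nn_integral_cmult_indicator emeasure_eq_measure ennreal_mult)
    also have "\<dots> \<le> (\<integral>\<^sup>+\<omega>. ennreal (energy (st m (Suc m) \<omega>)) \<partial>M)"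
    proof (rule nn_integral_mono)
      fix \<omega>
      have sum: "(\<Sum>i<k. X m i \<omega>) = b \<omega> (h m * real k) - b \<omega> 0" for k
        unfolding X_def using sum_lessThan_telescope[of "\<lambda>k. b \<omega> (h m * real k)" k] by simp
      have T: "h m * real (Suc m) = T" by (simp add: h_def)
      have "2 < fst (st m (Suc m) \<omega>) + snd (st m (Suc m) \<omega>)" if "\<omega> \<in> A"
      proof (rule ccontr)
        assume "\<not> ?thesis"
        then have *: "fst (st m (Suc m) \<omega>) + snd (st m (Suc m) \<omega>) \<le> 2" by simp
        have "b \<omega> T - b \<omega> 0 \<le> 2" "b \<omega> 0 - b \<omega> T \<le> 2"
          using range_moves_bound_differences[OF *[unfolded st_def], of "Suc m" 0]
            range_moves_bound_differences[OF *[unfolded st_def], of 0 "Suc m"]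
          unfolding sum T by simp_all
        moreover have "2 < \<bar>b \<omega> T - b \<omega> 0\<bar>" using that by (simp add: A_def)
        ultimately show False by linarith
      qed
      then show "2 * indicator A \<omega> \<le> ennreal (energy (st m (Suc m) \<omega>))"
        using energy_ge_2[of "\<lambda>i. X m i \<omega>" "Suc m"] unfolding st_def
        by (cases "\<omega> \<in> A") (simp_all add: ennreal_leI flip: ennreal_numeral)
    qed
    also have "\<dots> \<le> (\<integral>\<^sup>+\<omega>. grid_clock (b \<omega>) T m \<partial>M)"
      using en(2)[of m "Suc m"] unfolding clock st_def .
    finally show ?thesis .
  qed
  \<comment> \<open>The finite horizon supplies the integrable majorant for the reverse Fatou
    lemma.\<close>
  have bound: "AE \<omega> in M. grid_clock (b \<omega>) T m \<le> ennreal T" for m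
  proof (rule AE_I2)
    fix \<omega>
    have "grid_clock (b \<omega>) T m \<le> (\<Sum>k<Suc m. ennreal (h m))"
      unfolding clock by (intro sum_mono) (simp add: indicator_def)
    also have "\<dots> = ennreal (\<Sum>k<Suc m. h m)"
      using h[of m] by (intro sum_ennreal) simp
    also have "(\<Sum>k<Suc m. h m) = T"
      unfolding h_def by (simp del: of_nat_Suc)
    finally show "grid_clock (b \<omega>) T m \<le> ennreal T" .
  qed
  have "ennreal (2 * (1 - 4 / sqrt (2 * pi * T))) \<le> limsup (\<lambda>m. \<integral>\<^sup>+\<omega>. grid_clock (b \<omega>) T m \<partial>M)"
    by (intro le_Limsup sequentially_bot always_eventually allI lower)
  also have "\<dots> \<le> (\<integral>\<^sup>+\<omega>. limsup (\<lambda>m. grid_clock (b \<omega>) T m) \<partial>M)"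
    by (rule nn_integral_limsup[OF meas _ bound]) (simp_all add: emeasure_space_1)
  also have "\<dots> \<le> (\<integral>\<^sup>+\<omega>. inradius_time W \<omega> \<partial>M)"
  proof (rule nn_integral_mono_AE)
    show "AE \<omega> in M. limsup (\<lambda>m. grid_clock (b \<omega>) T m) \<le> inradius_time W \<omega>"
      using AE_continuous_from_zero
    proof eventually_elim
      case (elim \<omega>)
      then have cont: "continuous_on {0..} (\<lambda>t. W t \<omega>)" by simp
      have contb: "continuous_on {0..} (b \<omega>)"
        unfolding b_def by (intro continuous_intros cont)
      show ?case
        unfolding inradius_time_def
      proof (rule INF_greatest)
        fix t assume "t \<in> {t. 0 \<le> t \<and> 1 < inradius (path_hull W \<omega> t)}"
        then obtain r s where "r \<in> {0..t}" "s \<in> {0..t}" "2 < b \<omega> r - b \<omega> s"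
          using inradius_gt_1_imp_wide[of W \<omega> t, OF cont] unfolding b_def by blast
        then show "limsup (\<lambda>m. grid_clock (b \<omega>) T m) \<le> ennreal t"
          using limsup_grid_clock_le[OF contb assms, of r t s] by simp
      qed
    qed
  qed
  finally show ?thesis .
qed

text \<open>The horizon \<open>T\<close> tends to infinity.\<close>

lemma expectation_inradius_time_ge: "2 \<le> (\<integral>\<^sup>+\<omega>. inradius_time W \<omega> \<partial>M)"
proof (rule tendsto_upperbound)
  show "((\<lambda>T. ennreal (2 * (1 - 4 / sqrt (2 * pi * T)))) \<longlongrightarrow> 2) at_top"
  proof -
    have "((\<lambda>T. 2 * (1 - 4 / sqrt (2 * pi * T))) \<longlongrightarrow> 2) at_top" by real_asymp
    from tendsto_ennrealI[OF this] show ?thesis by simp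
  qed
  show "\<forall>\<^sub>F T in at_top. ennreal (2 * (1 - 4 / sqrt (2 * pi * T))) \<le> (\<integral>\<^sup>+\<omega>. inradius_time W \<omega> \<partial>M)"
    using eventually_gt_at_top[of "0 :: real"] by eventually_elim (rule expectation_inradius_time_ge_horizon)
qed simp

end

theorem proposition1p11:
  fixes M :: "'a measure" and W :: "real \<Rightarrow> 'a \<Rightarrow> real ^ 2"
  assumes "standard_planar_brownian_motion M W"
  shows "2 \<le> (\<integral>\<^sup>+ \<omega>. inradius_time W \<omega> \<partial>M) \<and> (\<integral>\<^sup>+ \<omega>. inradius_time W \<omega> \<partial>M) \<le> ennreal 83.4"
proof -
  interpret standard_planar_brownian_motion M W by (rule assms)
  show ?thesis
    using expectation_inradius_time_ge expectation_inradius_time_le by blast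
qed

end
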